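(* Let $\gamma>\gamma_0$. If $w\in L^2(0,\infty;H)$ and $u^0\in H$, then the unique solution of $$\frac{du}{dt}+\mathcal{A}_{\mathcal{R}}u=B_2w,\qquad u(0)=u^0,$$ satisfies $$\int_0^\infty|u(t)|^2\,dt+\int_0^\infty|B_1^*\mathcal{R}u(t)|^2\,dt\le C|u^0|^2+\gamma\int_0^\infty|w(t)|^2\,dt,$$ where $C>0$ is a constant independent of $u^0$ and $w$.
   Context: $H=\ell^2(\mathbb{C})$ (complex sequences indexed by $n\ge 1$) with $(u,v)=\sum_{n\ge1}u_nv_n^*$ and $|u|=(u,u)^{1/2}$. Fix $\lambda>1$, $k_0>0$, $k_n=k_0\lambda^n$, $\nu>0$, and constants $a,b,c$ with $a+b+c=0$. Let $(\phi_n)$ be the canonical basis of $H$. $A\phi_n=k_n^2\phi_n$, with $D(A)=\{u\in H:|Au|<\infty\}$; $V=D(A^{1/2})$ with norm $\|u\|=|A^{1/2}u|$. The map $B$ is $$B(u,v)=-i\sum_{n=1}^\infty\big(ak_{n+1}v_{n+2}u_{n+1}^*+bk_nv_{n+1}u_{n-1}^*+ak_{n-1}u_{n-1}v_{n-2}+bk_{n-1}v_{n-1}u_{n-2}\big)\phi_n,$$ with $u_0=u_{-1}=v_0=v_{-1}=0$ (in these component formulas $^*$ is complex conjugation). $u_e$ is a solution of $\nu Au_e+B(u_e,u_e)=f$. The linearized operator is $\mathcal{A}u=\nu Au+B(u,u_e)+B(u_e,u)$ with $D(\mathcal{A})=D(A)$; $-\mathcal{A}$ generates an analytic $C_0$-semigroup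 on $H$. $B_1,B_2\in\mathcal{L}(H,H)$, $\gamma>0$. Consider the linear system $\frac{du}{dt}+\mathcal{A}u=B_1U+B_2w$, $u(0)=u^0\in H$, with control $U\in L^2(0,\infty;H)$ and disturbance $w\in L^2(0,\infty;H)$, and $$\mathcal{J}(u,U,w)=\frac12\int_0^\infty|u|^2\,dt+\frac12\int_0^\infty|U|^2\,dt-\frac\gamma2\int_0^\infty|w|^2\,dt.$$ Put $P(u^0,w)=\inf_U\mathcal{J}(u,U,w)$ and $P(u^0)=\sup_{w\in L^2(0,\infty;H)}P(u^0,w)$. $\gamma_0>0$ is the threshold such that for $\gamma>\gamma_0$ the supremum is attained at a unique $\hat w$, while for $\gamma<\gamma_0$ it is $+\infty$. For $\gamma>\gamma_0$ let $\hat u$ be the optimal state for $(u^0,\hat w)$ and let $r_{u^0}$ be the associated solution of $-\frac{dr}{dt}+\mathcal{A}^*r=\hat u$, $r(\infty)=0$; $\mathcal{R}\in\mathcal{L}(H)$ is defined by $\mathcal{R}u^0=r_{u^0}(0)$, so that $P(u^0)=\frac12(u^0,\mathcal{R}u^0)$. $\mathcal{R}$ is symmetric, positive and satisfies $$\mathcal{A}^*\mathcal{R}+\mathcal{R}\mathcal{A}+\mathcal{R}B_1B_1^*\mathcal{R}-\frac1\gamma\mathcal{R}B_2B_2^*\mathcal{R}-I=0.$$ The closed loop operator is $\mathcal{A}_{\mathcal{R}}u=\mathcal{A}u+B_1B_1^*\mathcal{R}u$ with $D(\mathcal{A}_{\mathcal{R}})=\{u\in H:\mathcal{A}u+B_1B_1^*\mathcal{R}u\in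 H\}$. *)

theory Defs
  imports "HOL-Analysis.Analysis"
begin

section \<open>The Hilbert space of square-summable complex sequences\<close>

text \<open>
  Sequences indexed by \<open>n \<ge> 1\<close> are represented by functions on \<^typ>\<open>nat\<close> that vanish
  at \<open>0\<close>. Since subtraction on \<^typ>\<open>nat\<close> truncates, this also implements the conventions
  \<open>u\<^sub>0 = u\<^sub>-\<^sub>1 = 0\<close>.
\<close>

definition ell2_seq :: "(nat \<Rightarrow> complex) set" where
  "ell2_seq = {f. f 0 = 0 \<and> summable (\<lambda>n. (cmod (f n))\<^sup>2)}"

typedef ell2 = ell2_seq
  morphisms coord Abs_ell2
  by (rule exI[of _ "\<lambda>_. 0"]) (simp add: ell2_seq_def)

lemma ell2_eqI: "(\<And>n. coord u n = coord v n) \<Longrightarrow> u = v"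
  by (metis coord_inject ext)

lemma coord_0_index [simp]: "coord u 0 = 0"
  using coord[of u] by (simp add: ell2_seq_def)

lemma summable_coord: "summable (\<lambda>n. (cmod (coord u n))\<^sup>2)"
  using coord[of u] by (simp add: ell2_seq_def)

lemma coord_Abs: "f \<in> ell2_seq \<Longrightarrow> coord (Abs_ell2 f) = f"
  by (rule Abs_ell2_inverse)

lemma ell2_seq_zero: "(\<lambda>_. 0) \<in> ell2_seq"
  by (simp add: ell2_seq_def)

lemma ell2_seq_add:
  assumes "f \<in> ell2_seq" "g \<in> ell2_seq"
  shows "(\<lambda>n. f n + g n) \<in> ell2_seq"
proof -
  have s: "summable (\<lambda>n. 2 * ((cmod (f n))\<^sup>2 + (cmod (g n))\<^sup>2))"
    using assms by (intro summable_mult summable_add) (auto simp: ell2_seq_def)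
  have "(cmod (f n + g n))\<^sup>2 \<le> 2 * ((cmod (f n))\<^sup>2 + (cmod (g n))\<^sup>2)" for n
  proof -
    have "(cmod (f n + g n))\<^sup>2 \<le> (cmod (f n) + cmod (g n))\<^sup>2"
      by (intro power_mono norm_triangle_ineq norm_ge_zero)
    also have "\<dots> \<le> 2 * ((cmod (f n))\<^sup>2 + (cmod (g n))\<^sup>2)"
      using sum_squares_ge_zero[of "cmod (f n) - cmod (g n)" 0]
      by (simp add: power2_eq_square algebra_simps)
    finally show ?thesis .
  qed
  then have "summable (\<lambda>n. (cmod (f n + g n))\<^sup>2)"
    by (intro summable_comparison_test'[OF s, of 0]) auto
  then show ?thesis using assms by (simp add: ell2_seq_def)
qed

lemma ell2_seq_mult:
  assumes "f \<in> ell2_seq"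
  shows "(\<lambda>n. c * f n) \<in> ell2_seq"
  using assms by (simp add: ell2_seq_def norm_mult power_mult_distrib summable_mult)

instantiation ell2 :: real_vector
begin

definition "0 = Abs_ell2 (\<lambda>_. 0)"
definition "u + v = Abs_ell2 (\<lambda>n. coord u n + coord v n)"
definition "u - v = Abs_ell2 (\<lambda>n. coord u n - coord v n)"
definition "- u = Abs_ell2 (\<lambda>n. - coord u n)"
definition "r *\<^sub>R u = Abs_ell2 (\<lambda>n. r *\<^sub>R coord u n)"

lemma coord_zero [simp]: "coord 0 n = 0"
  by (simp add: zero_ell2_def coord_Abs ell2_seq_zero)

lemma coord_add [simp]: "coord (u + v) n = coord u n + coord v n"
  by (simp add: plus_ell2_def coord_Abs ell2_seq_add coord)

lemma coord_uminus [simp]: "coord (- u) n = - coord u n"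
  using ell2_seq_mult[OF coord[of u], of "-1"] by (simp add: uminus_ell2_def coord_Abs)

lemma coord_diff [simp]: "coord (u - v) n = coord u n - coord v n"
  using ell2_seq_add[OF coord[of u] ell2_seq_mult[OF coord[of v], of "-1"]]
  by (simp add: minus_ell2_def coord_Abs)

lemma coord_scaleR [simp]: "coord (r *\<^sub>R u) n = r *\<^sub>R coord u n"
  using ell2_seq_mult[OF coord[of u], of "of_real r"]
  by (simp add: scaleR_ell2_def coord_Abs scaleR_conv_of_real)

instance
  by standard (auto intro!: ell2_eqI simp: algebra_simps)

end

lemma summable_coord_mult: "summable (\<lambda>n. coord u n * cnj (coord v n))"
proof (rule summable_comparison_test'[where N = 0])
  show "summable (\<lambda>n. (cmod (coord u n))\<^sup>2 + (cmod (coord v n))\<^sup>2)"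
    by (intro summable_add summable_coord)
  fix n :: nat
  have "2 * (cmod (coord u n) * cmod (coord v n)) \<le> (cmod (coord u n))\<^sup>2 + (cmod (coord v n))\<^sup>2"
    using sum_squares_bound[of "cmod (coord u n)" "cmod (coord v n)"] by simp
  moreover have "0 \<le> cmod (coord u n) * cmod (coord v n)" by simp
  ultimately have "cmod (coord u n) * cmod (coord v n) \<le> (cmod (coord u n))\<^sup>2 + (cmod (coord v n))\<^sup>2"
    by linarith
  then show "norm (coord u n * cnj (coord v n)) \<le> (cmod (coord u n))\<^sup>2 + (cmod (coord v n))\<^sup>2"
    by (simp add: norm_mult)
qed

text \<open>
  The maps studied below involve complex conjugation and are only real-linear, so the space is
  used as a real Hilbert space: the inner product is the real part of \<open>\<Sum>n. u\<^sub>n v\<^sub>n\<^sup>*\<close>, and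
  adjoints are taken with respect to it. The norm is unaffected, and for a complex-linear
  operator this adjoint is the usual complex one.
\<close>

instantiation ell2 :: real_inner
begin

definition "inner u v = Re (\<Sum>n. coord u n * cnj (coord v n))"
definition "norm (u :: ell2) = sqrt (\<Sum>n. (cmod (coord u n))\<^sup>2)"
definition "sgn (u :: ell2) = inverse (norm u) *\<^sub>R u"
definition "dist (u :: ell2) v = norm (u - v)"
definition "(uniformity :: (ell2 \<times> ell2) filter) = (INF e\<in>{0<..}. principal {(x, y). dist x y < e})"
definition "open (S :: ell2 set) = (\<forall>x\<in>S. \<forall>\<^sub>F (x', y) in uniformity. x' = x \<longrightarrow> y \<in> S)"

lemma inner_ell2_suminf: "inner u v = (\<Sum>n. Re (coord u n * cnj (coord v n)))"
  unfolding inner_ell2_def using Re_suminf[OF summable_coord_mult] by simp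

lemma summable_Re_coord: "summable (\<lambda>n. Re (coord u n * cnj (coord v n)))"
  using summable_Re[OF summable_coord_mult] .

lemma inner_ell2_self: "inner u u = (\<Sum>n. (cmod (coord u n))\<^sup>2)"
  unfolding inner_ell2_suminf cmod_power2 by (simp add: power2_eq_square)

instance
proof
  fix x y z :: ell2 and r :: real
  show "inner x y = inner y x"
    by (simp add: inner_ell2_suminf mult.commute)
  show "inner (x + y) z = inner x z + inner y z"
    unfolding inner_ell2_suminf
    by (subst suminf_add[OF summable_Re_coord summable_Re_coord]) (simp add: algebra_simps)
  show "inner (r *\<^sub>R x) y = r * inner x y"
    unfolding inner_ell2_suminf
    by (subst suminf_mult[OF summable_Re_coord, symmetric]) (simp add: algebra_simps)
  show "0 \<le> inner x x"
    unfolding inner_ell2_self by (intro suminf_nonneg summable_coord) auto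
  show "inner x x = 0 \<longleftrightarrow> x = 0"
    unfolding inner_ell2_self
    by (subst suminf_eq_zero_iff[OF summable_coord]) (auto intro: ell2_eqI)
  show "norm x = sqrt (inner x x)"
    by (simp add: norm_ell2_def inner_ell2_self)
qed (simp_all add: sgn_ell2_def dist_ell2_def uniformity_ell2_def open_ell2_def)

end

lemma norm_ell2_sq: "(norm u)\<^sup>2 = (\<Sum>n. (cmod (coord u n))\<^sup>2)"
  by (simp add: power2_norm_eq_inner inner_ell2_self)

lemma partial_sum_le_norm: "(\<Sum>n<N. (cmod (coord u n))\<^sup>2) \<le> (norm u)\<^sup>2"
  unfolding norm_ell2_sq by (intro sum_le_suminf summable_coord) auto

lemma cmod_coord_le: "cmod (coord u n) \<le> norm u"
proof -
  have "(cmod (coord u n))\<^sup>2 \<le> (\<Sum>k<Suc n. (cmod (coord u k))\<^sup>2)"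
    by (simp add: sum_nonneg)
  also have "\<dots> \<le> (norm u)\<^sup>2" by (rule partial_sum_le_norm)
  finally show ?thesis by (rule power2_le_imp_le) simp
qed

instance ell2 :: complete_space
proof
  fix X :: "nat \<Rightarrow> ell2"
  assume X: "Cauchy X"
  have "Cauchy (\<lambda>m. coord (X m) n)" for n
  proof (rule CauchyI)
    fix e :: real assume "0 < e"
    obtain M where M: "\<And>m k. m \<ge> M \<Longrightarrow> k \<ge> M \<Longrightarrow> norm (X m - X k) < e"
      using CauchyD[OF X \<open>0 < e\<close>] by blast
    have "norm (coord (X m) n - coord (X k) n) < e" if "m \<ge> M" "k \<ge> M" for m k
      using M[OF that] cmod_coord_le[of "X m - X k" n] by simp
    then show "\<exists>M. \<forall>m\<ge>M. \<forall>k\<ge>M. norm (coord (X m) n - coord (X k) n) < e" by blast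
  qed
  then have "\<exists>l. (\<lambda>m. coord (X m) n) \<longlonglongrightarrow> l" for n
    using Cauchy_convergent convergent_def by blast
  then obtain l where l: "\<And>n. (\<lambda>m. coord (X m) n) \<longlonglongrightarrow> l n" by metis
  have l0: "l 0 = 0" using LIMSEQ_unique[OF l[of 0]] by simp
  have key: "\<exists>M. \<forall>m\<ge>M. (\<lambda>n. coord (X m) n - l n) \<in> ell2_seq \<and>
               (\<Sum>n. (cmod (coord (X m) n - l n))\<^sup>2) \<le> e\<^sup>2" if "e > 0" for e
  proof -
    obtain M where M: "\<And>m k. m \<ge> M \<Longrightarrow> k \<ge> M \<Longrightarrow> norm (X m - X k) < e"
      using CauchyD[OF X \<open>e > 0\<close>] by blast
    have bd: "(\<Sum>n<N. (cmod (coord (X m) n - l n))\<^sup>2) \<le> e\<^sup>2" if "m \<ge> M" for m N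
    proof (rule LIMSEQ_le_const2)
      show "(\<lambda>k. \<Sum>n<N. (cmod (coord (X m) n - coord (X k) n))\<^sup>2)
              \<longlonglongrightarrow> (\<Sum>n<N. (cmod (coord (X m) n - l n))\<^sup>2)"
        by (intro tendsto_intros l)
      have "(\<Sum>n<N. (cmod (coord (X m) n - coord (X k) n))\<^sup>2) \<le> e\<^sup>2" if "k \<ge> M" for k
        using partial_sum_le_norm[where u = "X m - X k" and N = N] M[OF \<open>m \<ge> M\<close> that]
          power_mono[of "norm (X m - X k)" e 2] by simp
      then show "\<exists>K. \<forall>k\<ge>K. (\<Sum>n<N. (cmod (coord (X m) n - coord (X k) n))\<^sup>2) \<le> e\<^sup>2" by blast
    qed
    have "summable (\<lambda>n. (cmod (coord (X m) n - l n))\<^sup>2)" if "m \<ge> M" for m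
      by (rule summableI_nonneg_bounded[OF _ bd[OF that]]) auto
    then show ?thesis
      using bd l0 by (intro exI[of _ M]) (auto simp: ell2_seq_def intro: suminf_le_const)
  qed
  obtain M where "(\<lambda>n. coord (X M) n - l n) \<in> ell2_seq" using key[of 1] by auto
  from ell2_seq_add[OF coord[of "X M"] ell2_seq_mult[OF this, of "-1"]]
  have cl: "coord (Abs_ell2 l) = l" by (simp add: coord_Abs)
  have "X \<longlonglongrightarrow> Abs_ell2 l"
  proof (rule LIMSEQ_I)
    fix r :: real assume "0 < r"
    with key[of "r / 2"] obtain M where
      M: "\<And>m. m \<ge> M \<Longrightarrow> (\<Sum>n. (cmod (coord (X m) n - l n))\<^sup>2) \<le> (r / 2)\<^sup>2" by auto
    have "norm (X m - Abs_ell2 l) < r" if "m \<ge> M" for m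
    proof -
      have "(norm (X m - Abs_ell2 l))\<^sup>2 \<le> (r / 2)\<^sup>2"
        using M[OF that] by (simp add: norm_ell2_sq cl)
      then have "norm (X m - Abs_ell2 l) \<le> r / 2"
        by (rule power2_le_imp_le) (use \<open>0 < r\<close> in simp)
      then show ?thesis using \<open>0 < r\<close> by simp
    qed
    then show "\<exists>no. \<forall>n\<ge>no. norm (X n - Abs_ell2 l) < r" by blast
  qed
  then show "convergent X" by (auto simp: convergent_def)
qed

instance ell2 :: banach ..

definition rat_ell2 :: "(rat \<times> rat) list \<Rightarrow> ell2" where
  "rat_ell2 qs = Abs_ell2 (\<lambda>n. if 0 < n \<and> n < length qs
     then Complex (of_rat (fst (qs ! n))) (of_rat (snd (qs ! n))) else 0)"

lemma coord_rat_ell2: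
  "coord (rat_ell2 qs) n = (if 0 < n \<and> n < length qs
     then Complex (of_rat (fst (qs ! n))) (of_rat (snd (qs ! n))) else 0)"
proof -
  have "summable (\<lambda>n. (cmod (if 0 < n \<and> n < length qs
     then Complex (of_rat (fst (qs ! n))) (of_rat (snd (qs ! n))) else 0))\<^sup>2)"
    by (rule summable_finite[of "{..<length qs}"]) auto
  then show ?thesis unfolding rat_ell2_def by (subst coord_Abs) (auto simp: ell2_seq_def)
qed

lemma complex_rat_approx:
  assumes "e > 0" shows "\<exists>p q. cmod (z - Complex (of_rat p) (of_rat q)) < e"
proof -
  obtain p where p: "Re z < of_rat p" "of_rat p < Re z + e / 2"
    using of_rat_dense[of "Re z" "Re z + e / 2"] assms by auto
  obtain q where q: "Im z < of_rat q" "of_rat q < Im z + e / 2"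
    using of_rat_dense[of "Im z" "Im z + e / 2"] assms by auto
  have "cmod (z - Complex (of_rat p) (of_rat q)) \<le> \<bar>Re z - of_rat p\<bar> + \<bar>Im z - of_rat q\<bar>"
    using cmod_le[of "z - Complex (of_rat p) (of_rat q)"] by simp
  also have "\<dots> < e" using p q by linarith
  finally show ?thesis by blast
qed

lemma rat_ell2_dense:
  assumes "e > 0" shows "\<exists>qs. norm (u - rat_ell2 qs) < e"
proof -
  define s where "s = (\<lambda>n. (cmod (coord u n))\<^sup>2)"
  have ss: "summable s" unfolding s_def by (rule summable_coord)
  obtain N where N: "norm (\<Sum>i. s (i + N)) < e\<^sup>2 / 2"
    using suminf_exist_split[of "e\<^sup>2 / 2" s] ss assms by auto
  define d where "d = e / sqrt (2 * (real N + 1))"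
  have "d > 0" using assms by (simp add: d_def)
  have "\<exists>pq. cmod (coord u n - Complex (of_rat (fst pq)) (of_rat (snd pq))) < d" for n
  proof -
    obtain p q where "cmod (coord u n - Complex (of_rat p) (of_rat q)) < d"
      using complex_rat_approx[OF \<open>d > 0\<close>] by blast
    then show ?thesis by (intro exI[of _ "(p, q)"]) simp
  qed
  then have "\<exists>pq. \<forall>n. cmod (coord u n - Complex (of_rat (fst (pq n))) (of_rat (snd (pq n)))) < d"
    by (intro choice) simp
  then obtain pq where
    pq: "\<And>n. cmod (coord u n - Complex (of_rat (fst (pq n))) (of_rat (snd (pq n)))) < d"
    by blast
  define v where "v = rat_ell2 (map pq [0..<N])"
  define t where "t = (\<lambda>n. (cmod (coord (u - v) n))\<^sup>2)"
  have st: "summable t" unfolding t_def by (rule summable_coord)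
  have t1: "t n \<le> d\<^sup>2" if "n < N" for n
  proof (cases "n = 0")
    case False
    then have "cmod (coord (u - v) n) < d" using pq[of n] that by (simp add: v_def coord_rat_ell2)
    then show ?thesis unfolding t_def by (intro power_mono) auto
  qed (simp add: t_def)
  have t2: "t (i + N) = s (i + N)" for i
    by (simp add: t_def s_def v_def coord_rat_ell2)
  have "(norm (u - v))\<^sup>2 = (\<Sum>i. t (i + N)) + (\<Sum>i<N. t i)"
    unfolding norm_ell2_sq t_def[symmetric]
    using suminf_split_initial_segment[OF st, of N] by (simp add: t_def)
  also have "(\<Sum>i. t (i + N)) < e\<^sup>2 / 2" using N t2 by simp
  also have "(\<Sum>i<N. t i) \<le> real N * d\<^sup>2"
    using sum_bounded_above[of "{..<N}" t "d\<^sup>2"] t1 by simp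
  also have "real N * d\<^sup>2 \<le> e\<^sup>2 / 2"
    by (simp add: d_def power_divide field_simps)
  finally have "(norm (u - v))\<^sup>2 < e\<^sup>2" by simp
  then have "norm (u - v) < e" using assms by (simp add: power2_less_imp_less)
  then show ?thesis unfolding v_def by blast
qed

instance ell2 :: second_countable_topology
proof
  define B where "B = (\<lambda>(qs, k). ball (rat_ell2 qs) (inverse (real (Suc k)))) ` UNIV"
  have "countable B" unfolding B_def by (intro countable_image) simp
  moreover have "topological_basis B"
  proof (rule topological_basisI)
    fix S :: "ell2 set" and x assume S: "open S" "x \<in> S"
    then obtain e where e: "e > 0" "ball x e \<subseteq> S" using openE by blast
    obtain k where k: "inverse (real (Suc k)) < e / 2" using reals_Archimedean[of "e / 2"] e by auto
    obtain qs where qs: "norm (x - rat_ell2 qs) < inverse (real (Suc k))"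
      using rat_ell2_dense[of "inverse (real (Suc k))" x] by auto
    have "y \<in> S" if "y \<in> ball (rat_ell2 qs) (inverse (real (Suc k)))" for y
    proof -
      have "dist x y \<le> dist x (rat_ell2 qs) + dist (rat_ell2 qs) y" by (rule dist_triangle)
      also have "\<dots> < e" using qs that k by (simp add: dist_norm)
      finally show ?thesis using e by auto
    qed
    moreover have "x \<in> ball (rat_ell2 qs) (inverse (real (Suc k)))"
      using qs by (simp add: dist_norm norm_minus_commute)
    ultimately show "\<exists>B'\<in>B. x \<in> B' \<and> B' \<subseteq> S"
      unfolding B_def by (intro bexI[of _ "ball (rat_ell2 qs) (inverse (real (Suc k)))"]) auto
  qed (auto simp: B_def)
  ultimately show "\<exists>B::ell2 set set. countable B \<and> open = generate_topology B"
    using topological_basis_imp_subbasis by blast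
qed


section \<open>The shell model and its linearization\<close>

definition wavenumber :: "real \<Rightarrow> real \<Rightarrow> nat \<Rightarrow> real" where
  "wavenumber k0 lam n = k0 * lam ^ n"

definition A_seq :: "real \<Rightarrow> real \<Rightarrow> (nat \<Rightarrow> complex) \<Rightarrow> nat \<Rightarrow> complex" where
  "A_seq k0 lam u n = of_real ((wavenumber k0 lam n)\<^sup>2) * u n"

definition A_dom :: "real \<Rightarrow> real \<Rightarrow> ell2 set" where
  "A_dom k0 lam = {u. A_seq k0 lam (coord u) \<in> ell2_seq}"

definition A_op :: "real \<Rightarrow> real \<Rightarrow> ell2 \<Rightarrow> ell2" where
  "A_op k0 lam u = Abs_ell2 (A_seq k0 lam (coord u))"

definition B_seq ::
  "real \<Rightarrow> real \<Rightarrow> real \<Rightarrow> real \<Rightarrow> (nat \<Rightarrow> complex) \<Rightarrow> (nat \<Rightarrow> complex) \<Rightarrow> nat \<Rightarrow> complex" where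
  "B_seq k0 lam a b u v n = (let k = wavenumber k0 lam in
     if n = 0 then 0 else
       - \<i> * (of_real (a * k (n + 1)) * v (n + 2) * cnj (u (n + 1))
            + of_real (b * k n) * v (n + 1) * cnj (u (n - 1))
            + of_real (a * k (n - 1)) * u (n - 1) * v (n - 2)
            + of_real (b * k (n - 1)) * v (n - 1) * u (n - 2)))"

text \<open>
  \<open>B_seq\<close> is square-summable as soon as one of the two arguments lies in \<open>D(A\<^sup>1\<^sup>/\<^sup>2)\<close>; only such
  pairs of arguments occur below.
\<close>

definition B_op :: "real \<Rightarrow> real \<Rightarrow> real \<Rightarrow> real \<Rightarrow> ell2 \<Rightarrow> ell2 \<Rightarrow> ell2" where
  "B_op k0 lam a b u v = Abs_ell2 (B_seq k0 lam a b (coord u) (coord v))"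

definition lin_seq ::
  "real \<Rightarrow> real \<Rightarrow> real \<Rightarrow> real \<Rightarrow> real \<Rightarrow> ell2 \<Rightarrow> (nat \<Rightarrow> complex) \<Rightarrow> nat \<Rightarrow> complex" where
  "lin_seq k0 lam nu a b ue u n = of_real nu * A_seq k0 lam u n
     + B_seq k0 lam a b u (coord ue) n + B_seq k0 lam a b (coord ue) u n"

definition lin_op :: "real \<Rightarrow> real \<Rightarrow> real \<Rightarrow> real \<Rightarrow> real \<Rightarrow> ell2 \<Rightarrow> ell2 \<Rightarrow> ell2" where
  "lin_op k0 lam nu a b ue u =
     nu *\<^sub>R A_op k0 lam u + B_op k0 lam a b u ue + B_op k0 lam a b ue u"

text \<open>
  In the domain of the closed loop operator, \<open>\<A>u\<close> is read as a formal sequence for every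
  \<open>u \<in> H\<close>, and the requirement is that the sum be square-summable.
\<close>

definition closed_dom ::
  "real \<Rightarrow> real \<Rightarrow> real \<Rightarrow> real \<Rightarrow> real \<Rightarrow> ell2 \<Rightarrow> (ell2 \<Rightarrow> ell2) \<Rightarrow> (ell2 \<Rightarrow> ell2) \<Rightarrow> ell2 set" where
  "closed_dom k0 lam nu a b ue B1 R =
     {u. (\<lambda>n. lin_seq k0 lam nu a b ue (coord u) n + coord (B1 (adjoint B1 (R u))) n) \<in> ell2_seq}"

definition closed_op ::
  "real \<Rightarrow> real \<Rightarrow> real \<Rightarrow> real \<Rightarrow> real \<Rightarrow> ell2 \<Rightarrow> (ell2 \<Rightarrow> ell2) \<Rightarrow> (ell2 \<Rightarrow> ell2) \<Rightarrow> ell2 \<Rightarrow> ell2" where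
  "closed_op k0 lam nu a b ue B1 R u = lin_op k0 lam nu a b ue u + B1 (adjoint B1 (R u))"


section \<open>Linear evolution equations on the half line\<close>

text \<open>An unbounded operator is given by its domain \<open>D\<close> and a function \<open>L\<close>, used only on \<open>D\<close>.\<close>

definition adj_dom :: "ell2 set \<Rightarrow> (ell2 \<Rightarrow> ell2) \<Rightarrow> ell2 set" where
  "adj_dom D L = {y. \<exists>z. \<forall>x\<in>D. inner (L x) y = inner x z}"

definition adj_op :: "ell2 set \<Rightarrow> (ell2 \<Rightarrow> ell2) \<Rightarrow> ell2 \<Rightarrow> ell2" where
  "adj_op D L y = (THE z. \<forall>x\<in>D. inner (L x) y = inner x z)"

definition sq_int :: "(real \<Rightarrow> ell2) \<Rightarrow> ennreal" where
  "sq_int f = (\<integral>\<^sup>+ t\<in>{0..}. ennreal ((norm (f t))\<^sup>2) \<partial>lborel)"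

definition L2H :: "(real \<Rightarrow> ell2) set" where
  "L2H = {f. set_borel_measurable lborel {0..} f \<and> sq_int f < \<infinity>}"

text \<open>
  Solutions of \<open>du/dt + L u = g\<close>, \<open>u(0) = u0\<close>, are mild solutions: continuous functions that
  satisfy the equation integrated over \<open>[0, t]\<close>. When \<open>-L\<close> generates a strongly continuous
  semigroup these are exactly the functions given by the variation of constants formula.
\<close>

definition solves ::
  "ell2 set \<Rightarrow> (ell2 \<Rightarrow> ell2) \<Rightarrow> (real \<Rightarrow> ell2) \<Rightarrow> ell2 \<Rightarrow> (real \<Rightarrow> ell2) \<Rightarrow> bool" where
  "solves D L g u0 u \<longleftrightarrow> continuous_on {0..} u \<and>
     (\<forall>t\<ge>0. (LINT s:{0..t}|lborel. u s) \<in> D \<and>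
        u t + L (LINT s:{0..t}|lborel. u s) = u0 + (LINT s:{0..t}|lborel. g s))"

text \<open>The backward equation \<open>-dr/dt + L\<^sup>* r = g\<close>, \<open>r(\<infinity>) = 0\<close>, integrated over \<open>[s, t]\<close>.\<close>

definition solves_backward ::
  "ell2 set \<Rightarrow> (ell2 \<Rightarrow> ell2) \<Rightarrow> (real \<Rightarrow> ell2) \<Rightarrow> (real \<Rightarrow> ell2) \<Rightarrow> bool" where
  "solves_backward D L g r \<longleftrightarrow> continuous_on {0..} r \<and>
     (\<forall>s\<ge>0. \<forall>t\<ge>s. (LINT x:{s..t}|lborel. r x) \<in> adj_dom D L \<and>
        r s + adj_op D L (LINT x:{s..t}|lborel. r x) = r t + (LINT x:{s..t}|lborel. g x)) \<and>
     (r \<longlongrightarrow> 0) at_top"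


section \<open>The robust control problem\<close>

text \<open>
  The state need not be square-integrable, so the cost is extended-real; the two remaining
  terms are finite whenever \<open>U\<close> and \<open>w\<close> belong to \<open>L2H\<close>.
\<close>

definition cost :: "real \<Rightarrow> (real \<Rightarrow> ell2) \<Rightarrow> (real \<Rightarrow> ell2) \<Rightarrow> (real \<Rightarrow> ell2) \<Rightarrow> ereal" where
  "cost \<gamma> u U w = ereal (1 / 2) * enn2ereal (sq_int u) + ereal (1 / 2) * enn2ereal (sq_int U)
     - ereal (\<gamma> / 2) * enn2ereal (sq_int w)"

definition state_eq ::
  "ell2 set \<Rightarrow> (ell2 \<Rightarrow> ell2) \<Rightarrow> (ell2 \<Rightarrow> ell2) \<Rightarrow> (ell2 \<Rightarrow> ell2) \<Rightarrow>
   ell2 \<Rightarrow> (real \<Rightarrow> ell2) \<Rightarrow> (real \<Rightarrow> ell2) \<Rightarrow> (real \<Rightarrow> ell2) \<Rightarrow> bool" where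
  "state_eq D L B1 B2 u0 U w u \<longleftrightarrow> solves D L (\<lambda>t. B1 (U t) + B2 (w t)) u0 u"

definition inf_cost ::
  "ell2 set \<Rightarrow> (ell2 \<Rightarrow> ell2) \<Rightarrow> (ell2 \<Rightarrow> ell2) \<Rightarrow> (ell2 \<Rightarrow> ell2) \<Rightarrow> real \<Rightarrow>
   ell2 \<Rightarrow> (real \<Rightarrow> ell2) \<Rightarrow> ereal" where
  "inf_cost D L B1 B2 \<gamma> u0 w = Inf {cost \<gamma> u U w | u U. U \<in> L2H \<and> state_eq D L B1 B2 u0 U w u}"

definition game_value ::
  "ell2 set \<Rightarrow> (ell2 \<Rightarrow> ell2) \<Rightarrow> (ell2 \<Rightarrow> ell2) \<Rightarrow> (ell2 \<Rightarrow> ell2) \<Rightarrow> real \<Rightarrow> ell2 \<Rightarrow> ereal" where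
  "game_value D L B1 B2 \<gamma> u0 = (SUP w\<in>L2H. inf_cost D L B1 B2 \<gamma> u0 w)"

definition worst_disturbance ::
  "ell2 set \<Rightarrow> (ell2 \<Rightarrow> ell2) \<Rightarrow> (ell2 \<Rightarrow> ell2) \<Rightarrow> (ell2 \<Rightarrow> ell2) \<Rightarrow> real \<Rightarrow>
   ell2 \<Rightarrow> (real \<Rightarrow> ell2) \<Rightarrow> bool" where
  "worst_disturbance D L B1 B2 \<gamma> u0 w \<longleftrightarrow>
     w \<in> L2H \<and> inf_cost D L B1 B2 \<gamma> u0 w = game_value D L B1 B2 \<gamma> u0"

definition optimal_pair ::
  "ell2 set \<Rightarrow> (ell2 \<Rightarrow> ell2) \<Rightarrow> (ell2 \<Rightarrow> ell2) \<Rightarrow> (ell2 \<Rightarrow> ell2) \<Rightarrow> real \<Rightarrow>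
   ell2 \<Rightarrow> (real \<Rightarrow> ell2) \<Rightarrow> (real \<Rightarrow> ell2) \<Rightarrow> (real \<Rightarrow> ell2) \<Rightarrow> bool" where
  "optimal_pair D L B1 B2 \<gamma> u0 w u U \<longleftrightarrow>
     U \<in> L2H \<and> state_eq D L B1 B2 u0 U w u \<and> cost \<gamma> u U w = inf_cost D L B1 B2 \<gamma> u0 w"

text \<open>Elements of \<open>L2H\<close> are functions, so uniqueness in \<open>L\<^sup>2\<close> is uniqueness up to null sets.\<close>

definition gamma_threshold ::
  "ell2 set \<Rightarrow> (ell2 \<Rightarrow> ell2) \<Rightarrow> (ell2 \<Rightarrow> ell2) \<Rightarrow> (ell2 \<Rightarrow> ell2) \<Rightarrow> real \<Rightarrow> bool" where
  "gamma_threshold D L B1 B2 \<gamma>0 \<longleftrightarrow> 0 < \<gamma>0 \<and>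
     (\<forall>\<gamma>>\<gamma>0. \<forall>u0. game_value D L B1 B2 \<gamma> u0 < \<infinity> \<and>
        (\<exists>w. worst_disturbance D L B1 B2 \<gamma> u0 w \<and>
           (\<forall>w'. worst_disturbance D L B1 B2 \<gamma> u0 w' \<longrightarrow>
              (AE t in lborel. 0 \<le> t \<longrightarrow> w' t = w t)))) \<and>
     (\<forall>\<gamma>. 0 < \<gamma> \<and> \<gamma> < \<gamma>0 \<longrightarrow> (\<forall>u0. game_value D L B1 B2 \<gamma> u0 = \<infinity>))"

text \<open>
  If \<open>L\<^sup>*\<close> has spectrum in the left half plane, the homogeneous backward equation has decaying
  solutions, and \<open>r(\<infinity>) = 0\<close> alone does not single out the costate. The representation of the value function, which determines \<open>R\<close> among self-adjoint operators,
  is therefore part of the definition.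
\<close>

definition costate_operator ::
  "ell2 set \<Rightarrow> (ell2 \<Rightarrow> ell2) \<Rightarrow> (ell2 \<Rightarrow> ell2) \<Rightarrow> (ell2 \<Rightarrow> ell2) \<Rightarrow> real \<Rightarrow> (ell2 \<Rightarrow> ell2) \<Rightarrow> bool" where
  "costate_operator D L B1 B2 \<gamma> R \<longleftrightarrow> bounded_linear R \<and>
     (\<forall>u0. \<exists>w u U r. worst_disturbance D L B1 B2 \<gamma> u0 w \<and> optimal_pair D L B1 B2 \<gamma> u0 w u U \<and>
        solves_backward D L u r \<and> R u0 = r 0) \<and>
     (\<forall>u0. game_value D L B1 B2 \<gamma> u0 = ereal (1 / 2 * inner u0 (R u0)))"

definition riccati ::
  "ell2 set \<Rightarrow> (ell2 \<Rightarrow> ell2) \<Rightarrow> (ell2 \<Rightarrow> ell2) \<Rightarrow> (ell2 \<Rightarrow> ell2) \<Rightarrow> real \<Rightarrow> (ell2 \<Rightarrow> ell2) \<Rightarrow> bool" where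
  "riccati D L B1 B2 \<gamma> R \<longleftrightarrow>
     (\<forall>u\<in>D. R u \<in> adj_dom D L \<and>
        adj_op D L (R u) + R (L u) + R (B1 (adjoint B1 (R u)))
          - (1 / \<gamma>) *\<^sub>R R (B2 (adjoint B2 (R u))) - u = 0)"

end

theory Submission
  imports Defs
begin

text \<open>
  The linearization is harmless because \<open>u\<^sub>e\<close> lies in \<open>D(A)\<close>: every coefficient of
  \<open>B(u, u\<^sub>e) + B(u\<^sub>e, u)\<close> is a wave number times a neighbouring coordinate of \<open>u\<^sub>e\<close>, hence bounded
  uniformly in \<open>n\<close> (\<open>A_dom_weighted_bound\<close>). So \<open>\<A>\<close>, and with it the closed loop operator, is a
  \<^emph>\<open>bounded\<close> perturbation of the diagonal operator \<open>\<nu>A\<close> with the same domain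
  (\<open>closed_loop_eq_perturbed_diagonal\<close>). Existence of the mild solution follows from the contraction
  principle applied to the Duhamel formula of the diagonal semigroup
  (\<open>exists_perturbed_solution\<close>), uniqueness from a Gronwall argument
  (\<open>perturbed_solution_unique\<close>).

  The estimate comes from the storage function \<open>(u, \<R>u)\<close>. By the Riccati equation, formally
  \<open>d/dt (u, \<R>u) = - |u|\<^sup>2 - |B\<^sub>1\<^sup>*\<R>u|\<^sup>2 + \<gamma>|w|\<^sup>2 - \<gamma>|w - B\<^sub>2\<^sup>*\<R>u / \<gamma>|\<^sup>2\<close>;
  integrating, discarding the last square and using \<open>\<R> \<ge> 0\<close> at the final time leaves
  \<open>(u\<^sub>0, \<R>u\<^sub>0) + \<gamma> \<integral>|w|\<^sup>2\<close> on the right, so that any bound of the norm of \<open>\<R>\<close> serves as \<open>C\<close>.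

  A mild solution need not be differentiable or take values in the domain. Its moving averages
  \<open>u\<^sub>h(t) = (1/h) \<integral> u\<close> over \<open>[t, t + h]\<close> do both, and they solve the same equation with \<open>w\<close> replaced by
  its moving average \<open>w\<^sub>h\<close>. The computation is therefore carried out for \<open>u\<^sub>h\<close>
  (\<open>steklov_energy_estimate\<close>); averaging does not increase the \<open>L\<^sup>2\<close> norm of the disturbance
  (\<open>steklov_sq_int_le\<close>), and Fatou's lemma removes \<open>h\<close> (\<open>energy_estimate\<close>).
\<close>


section \<open>Diagonal operators on square-summable sequences\<close>

definition diag :: "(nat \<Rightarrow> real) \<Rightarrow> ell2 \<Rightarrow> ell2" where
  "diag c u = Abs_ell2 (\<lambda>n. of_real (c n) * coord u n)"

definition contractive_weights :: "(nat \<Rightarrow> real) \<Rightarrow> bool" where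
  "contractive_weights c \<longleftrightarrow> (\<forall>n. \<bar>c n\<bar> \<le> 1)"

lemma ell2_seq_comparison:
  assumes "f 0 = 0" "summable g" "\<And>n. (cmod (f n))\<^sup>2 \<le> g n"
  shows "f \<in> ell2_seq" and "(norm (Abs_ell2 f))\<^sup>2 \<le> suminf g"
proof -
  have s: "summable (\<lambda>n. (cmod (f n))\<^sup>2)"
    by (rule summable_comparison_test'[OF assms(2), of 0]) (use assms(3) in auto)
  then show f: "f \<in> ell2_seq" using assms(1) by (simp add: ell2_seq_def)
  show "(norm (Abs_ell2 f))\<^sup>2 \<le> suminf g"
    using suminf_le[OF assms(3) s assms(2)] by (simp add: norm_ell2_sq coord_Abs[OF f])
qed

lemma diag_seq_bound:
  assumes "contractive_weights c"
  shows "(cmod (of_real (c n) * coord u n))\<^sup>2 \<le> (cmod (coord u n))\<^sup>2"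
proof -
  have "\<bar>c n\<bar> * cmod (coord u n) \<le> 1 * cmod (coord u n)"
    using assms by (intro mult_right_mono) (auto simp: contractive_weights_def)
  then have "cmod (of_real (c n) * coord u n) \<le> cmod (coord u n)" by (simp add: norm_mult)
  then show ?thesis by (rule power_mono) simp
qed

lemma coord_diag:
  assumes "contractive_weights c"
  shows "coord (diag c u) n = of_real (c n) * coord u n"
  unfolding diag_def
  by (subst coord_Abs, rule ell2_seq_comparison(1)[OF _ summable_coord diag_seq_bound])
    (use assms in auto)

lemma norm_diag_le:
  assumes "contractive_weights c"
  shows "norm (diag c u) \<le> norm u"
proof -
  have "(norm (diag c u))\<^sup>2 \<le> (norm u)\<^sup>2"
    unfolding diag_def norm_ell2_sq[of u]
    by (rule ell2_seq_comparison(2)[OF _ summable_coord diag_seq_bound]) (use assms in auto)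
  then show ?thesis by (rule power2_le_imp_le) simp
qed

lemma diag_diff: "contractive_weights c \<Longrightarrow> diag c (u - v) = diag c u - diag c v"
  by (rule ell2_eqI) (simp add: coord_diag algebra_simps)

lemma diag_scaleR: "contractive_weights c \<Longrightarrow> diag c (r *\<^sub>R u) = r *\<^sub>R diag c u"
  by (rule ell2_eqI) (simp add: coord_diag scaleR_conv_of_real algebra_simps)

text \<open>
  Coordinatewise convergence of the weights suffices for strong convergence, by dominated
  convergence for series: \<open>4 |u\<^sub>n|\<^sup>2\<close> dominates \<open>|c\<^sub>j(n) - c(n)|\<^sup>2 |u\<^sub>n|\<^sup>2\<close>. Both the convergence
  of truncations and the strong continuity of the semigroup generated by a diagonal operator
  are instances.
\<close>

lemma diag_tendsto:
  assumes "\<And>n. (\<lambda>j. c j n) \<longlonglongrightarrow> d n"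
    and c: "\<And>j. contractive_weights (c j)" and d: "contractive_weights d"
  shows "(\<lambda>j. diag (c j) u) \<longlonglongrightarrow> diag d u"
proof -
  have co: "(cmod (coord (diag (c j) u - diag d u) n))\<^sup>2 = (\<bar>c j n - d n\<bar> * cmod (coord u n))\<^sup>2" for j n
  proof -
    have "coord (diag (c j) u - diag d u) n = of_real (c j n - d n) * coord u n"
      by (simp add: coord_diag c d algebra_simps)
    then show ?thesis by (simp only: norm_mult norm_of_real)
  qed
  have "(\<lambda>j. \<Sum>n. (cmod (coord (diag (c j) u - diag d u) n))\<^sup>2) \<longlonglongrightarrow> (\<Sum>n::nat. 0::real)"
  proof (rule tannerys_theorem[where M = "\<lambda>n. 4 * (cmod (coord u n))\<^sup>2",
      THEN conjunct2, THEN conjunct2])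
    fix n
    have "(\<lambda>j. (\<bar>c j n - d n\<bar> * cmod (coord u n))\<^sup>2) \<longlonglongrightarrow> (\<bar>d n - d n\<bar> * cmod (coord u n))\<^sup>2"
      by (intro tendsto_intros assms)
    then show "(\<lambda>j. (cmod (coord (diag (c j) u - diag d u) n))\<^sup>2) \<longlonglongrightarrow> 0"
      unfolding co by simp
  next
    have "norm ((cmod (coord (diag (c j) u - diag d u) n))\<^sup>2) \<le> 4 * (cmod (coord u n))\<^sup>2" for j n
    proof -
      have "\<bar>c j n - d n\<bar> * cmod (coord u n) \<le> 2 * cmod (coord u n)"
        using c[of j, unfolded contractive_weights_def, rule_format, of n]
          d[unfolded contractive_weights_def, rule_format, of n]
        by (intro mult_right_mono) auto
      then have "(\<bar>c j n - d n\<bar> * cmod (coord u n))\<^sup>2 \<le> (2 * cmod (coord u n))\<^sup>2"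
        by (intro power_mono) auto
      then show ?thesis unfolding co by (simp add: power_mult_distrib)
    qed
    then show "\<forall>\<^sub>F (n, j) in at_top \<times>\<^sub>F sequentially.
        norm ((cmod (coord (diag (c j) u - diag d u) n))\<^sup>2) \<le> 4 * (cmod (coord u n))\<^sup>2"
      by (intro always_eventually) auto
  qed (auto intro: summable_mult summable_coord)
  then have "(\<lambda>j. (norm (diag (c j) u - diag d u))\<^sup>2) \<longlonglongrightarrow> 0"
    by (simp add: norm_ell2_sq)
  then have "(\<lambda>j. sqrt ((norm (diag (c j) u - diag d u))\<^sup>2)) \<longlonglongrightarrow> sqrt 0"
    by (rule tendsto_real_sqrt)
  then show ?thesis by (subst LIM_zero_iff[symmetric]) (simp add: tendsto_norm_zero_iff)
qed

definition diag_dom :: "(nat \<Rightarrow> real) \<Rightarrow> ell2 set" where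
  "diag_dom \<mu> = {u. (\<lambda>n. of_real (\<mu> n) * coord u n) \<in> ell2_seq}"

lemma coord_diag_dom: "u \<in> diag_dom \<mu> \<Longrightarrow> coord (diag \<mu> u) n = of_real (\<mu> n) * coord u n"
  by (simp add: diag_dom_def diag_def coord_Abs)

lemma diag_dom_diff:
  assumes "x \<in> diag_dom \<mu>" "y \<in> diag_dom \<mu>"
  shows "x - y \<in> diag_dom \<mu>" "diag \<mu> (x - y) = diag \<mu> x - diag \<mu> y"
proof -
  have "(\<lambda>n. of_real (\<mu> n) * coord (x - y) n) = coord (diag \<mu> x - diag \<mu> y)"
    by (simp add: fun_eq_iff coord_diag_dom assms algebra_simps)
  then show "x - y \<in> diag_dom \<mu>"
    unfolding diag_dom_def using coord[of "diag \<mu> x - diag \<mu> y"] by (simp del: coord_diff)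
  then show "diag \<mu> (x - y) = diag \<mu> x - diag \<mu> y"
    by (intro ell2_eqI) (simp add: coord_diag_dom assms algebra_simps)
qed

lemma diag_dom_scaleR:
  assumes "x \<in> diag_dom \<mu>"
  shows "r *\<^sub>R x \<in> diag_dom \<mu>" "diag \<mu> (r *\<^sub>R x) = r *\<^sub>R diag \<mu> x"
proof -
  have "(\<lambda>n. of_real (\<mu> n) * coord (r *\<^sub>R x) n) = coord (r *\<^sub>R diag \<mu> x)"
    by (simp add: fun_eq_iff coord_diag_dom assms)
  then show "r *\<^sub>R x \<in> diag_dom \<mu>"
    unfolding diag_dom_def using coord[of "r *\<^sub>R diag \<mu> x"] by (simp del: coord_scaleR)
  then show "diag \<mu> (r *\<^sub>R x) = r *\<^sub>R diag \<mu> x"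
    by (intro ell2_eqI) (simp add: coord_diag_dom assms)
qed

lemma inner_diag_nonneg:
  assumes "\<And>n. 0 \<le> \<mu> n" "u \<in> diag_dom \<mu>"
  shows "0 \<le> inner u (diag \<mu> u)"
proof -
  have "coord u n * cnj (coord (diag \<mu> u) n) = of_real (\<mu> n * (cmod (coord u n))\<^sup>2)" for n
    by (simp only: coord_diag_dom[OF assms(2)] complex_norm_square of_real_mult
      complex_cnj_mult complex_cnj_complex_of_real mult.left_commute)
  then have "Re (coord u n * cnj (coord (diag \<mu> u) n)) = \<mu> n * (cmod (coord u n))\<^sup>2" for n
    by simp
  then show ?thesis
    unfolding inner_ell2_suminf using assms(1)
    by (intro suminf_nonneg summable_Re_coord) auto
qed

lemma bounded_linear_coord: "bounded_linear (\<lambda>u. coord u n)"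
  by (rule bounded_linear_intro[where K = 1]) (auto simp: cmod_coord_le)

definition basis :: "nat \<Rightarrow> complex \<Rightarrow> ell2" where
  "basis n z = Abs_ell2 (\<lambda>m. if m = n \<and> n \<noteq> 0 then z else 0)"

lemma coord_basis: "coord (basis n z) m = (if m = n \<and> n \<noteq> 0 then z else 0)"
proof -
  have "summable (\<lambda>m. (cmod (if m = n \<and> n \<noteq> 0 then z else 0))\<^sup>2)"
    by (rule summable_finite[of "{n}"]) auto
  then show ?thesis unfolding basis_def by (subst coord_Abs) (auto simp: ell2_seq_def)
qed

lemma norm_basis_le: "norm (basis n z) \<le> cmod z"
proof -
  have "(norm (basis n z))\<^sup>2 = (\<Sum>m\<in>{n}. (cmod (coord (basis n z) m))\<^sup>2)"
    unfolding norm_ell2_sq by (rule suminf_finite) (auto simp: coord_basis)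
  also have "\<dots> \<le> (cmod z)\<^sup>2" by (simp add: coord_basis)
  finally show ?thesis by (rule power2_le_imp_le) simp
qed

lemma bounded_linear_basis: "bounded_linear (basis n)"
  by (rule bounded_linear_intro[where K = 1])
    (auto intro!: ell2_eqI simp: coord_basis norm_basis_le)

definition truncate :: "nat \<Rightarrow> ell2 \<Rightarrow> ell2" where
  "truncate N u = (\<Sum>n<N. basis n (coord u n))"

lemma coord_sum: "coord (sum f A) n = (\<Sum>i\<in>A. coord (f i) n)"
  by (induction A rule: infinite_finite_induct) auto

lemma coord_truncate: "coord (truncate N u) n = (if n < N then coord u n else 0)"
proof -
  have "coord (truncate N u) n = (\<Sum>i<N. if n = i then coord u i else 0)"
    unfolding truncate_def coord_sum by (intro sum.cong) (auto simp: coord_basis)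
  then show ?thesis by simp
qed

lemma truncate_tendsto: "(\<lambda>N. truncate N u) \<longlonglongrightarrow> u"
proof -
  define c where "c N n = (if n < N then 1 else 0 :: real)" for N n :: nat
  have c: "contractive_weights (c N)" for N by (simp add: c_def contractive_weights_def)
  have 1: "contractive_weights (\<lambda>_. 1)" by (simp add: contractive_weights_def)
  have "(\<lambda>N. c N n) \<longlonglongrightarrow> 1" for n
    by (rule tendsto_eventually) (auto simp: c_def eventually_sequentially intro!: exI[of _ "Suc n"])
  then have "(\<lambda>N. diag (c N) u) \<longlonglongrightarrow> diag (\<lambda>_. 1) u"
    by (intro diag_tendsto c 1)
  moreover have "diag (c N) u = truncate N u" for N
    by (rule ell2_eqI) (simp add: coord_diag c coord_truncate, simp add: c_def)
  moreover have "diag (\<lambda>_. 1) u = u" by (rule ell2_eqI) (simp add: coord_diag 1)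
  ultimately show ?thesis by simp
qed

text \<open>
  The truncations are finite sums of continuous images of coordinates and converge pointwise.
\<close>

lemma borel_measurable_ell2I:
  assumes "\<And>n. (\<lambda>s. coord (f s) n) \<in> borel_measurable M"
  shows "f \<in> borel_measurable M"
proof (rule borel_measurable_LIMSEQ_metric)
  show "(\<lambda>s. truncate N (f s)) \<in> borel_measurable M" for N
    unfolding truncate_def
    by (intro borel_measurable_sum measurable_compose[OF assms]
      borel_measurable_continuous_onI linear_continuous_on bounded_linear_basis)
  show "(\<lambda>N. truncate N (f s)) \<longlonglongrightarrow> f s" for s by (rule truncate_tendsto)
qed

lemma borel_measurable_coord [measurable (raw)]:
  "f \<in> borel_measurable M \<Longrightarrow> (\<lambda>s. coord (f s) n) \<in> borel_measurable M"
  by (rule measurable_compose[OF _ borel_measurable_continuous_onI])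
    (auto intro: linear_continuous_on bounded_linear_coord)


section \<open>Riesz representation and adjoints\<close>

lemma basis_zero_index: "basis 0 z = 0"
  by (rule ell2_eqI) (simp add: coord_basis)

text \<open>
  The representing vector can only have the coordinates read off from the values of \<open>\<phi>\<close> on the real and
  imaginary unit vectors. Boundedness of \<open>\<phi>\<close> makes this sequence square-summable, and the two sides of
  the formula agree on truncations, hence everywhere.
\<close>

lemma riesz_representation:
  assumes "bounded_linear (\<phi> :: ell2 \<Rightarrow> real)"
  shows "\<exists>y. \<forall>x. \<phi> x = inner x y"
proof -
  interpret \<phi>: bounded_linear \<phi> by fact
  define y where "y n = Complex (\<phi> (basis n 1)) (\<phi> (basis n \<i>))" for n
  have y0: "y 0 = 0" by (simp add: y_def basis_zero_index complex_eq_iff)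
  have \<phi>_basis: "\<phi> (basis n z) = Re (z * cnj (y n))" for n z
  proof -
    have "basis n z = Re z *\<^sub>R basis n 1 + Im z *\<^sub>R basis n \<i>"
      by (rule ell2_eqI) (auto simp: coord_basis complex_eq_iff)
    then show ?thesis by (simp add: \<phi>.add \<phi>.scaleR y_def)
  qed
  have \<phi>_truncate: "\<phi> (truncate N x) = (\<Sum>n<N. Re (coord x n * cnj (y n)))" for N x
    by (simp add: truncate_def \<phi>.sum \<phi>_basis del: times_complex.sel)
  obtain K where K: "\<And>x. \<bar>\<phi> x\<bar> \<le> norm x * K" "K > 0" using \<phi>.pos_bounded by auto
  (* Testing the functional against the truncation of the candidate bounds its partial norms. *)
  have "(\<Sum>n<N. (cmod (y n))\<^sup>2) \<le> K\<^sup>2" for N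
  proof -
    define f where "f n = (if n < N then y n else 0)" for n
    define S where "S = (\<Sum>n<N. (cmod (y n))\<^sup>2)"
    have "summable (\<lambda>n. (cmod (f n))\<^sup>2)" by (rule summable_finite[of "{..<N}"]) (auto simp: f_def)
    then have f: "coord (Abs_ell2 f) = f" by (subst coord_Abs) (auto simp: ell2_seq_def f_def y0)
    have tf: "truncate N (Abs_ell2 f) = Abs_ell2 f"
      by (rule ell2_eqI) (simp add: coord_truncate f, simp add: f_def)
    have "(norm (Abs_ell2 f))\<^sup>2 = (\<Sum>n\<in>{..<N}. (cmod (f n))\<^sup>2)"
      unfolding norm_ell2_sq f by (rule suminf_finite) (auto simp: f_def)
    then have nf: "(norm (Abs_ell2 f))\<^sup>2 = S" by (simp add: S_def f_def)
    have "\<phi> (Abs_ell2 f) = (\<Sum>n<N. Re (f n * cnj (y n)))"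
      using \<phi>_truncate[of N "Abs_ell2 f"] by (simp add: tf f)
    also have "\<dots> = S" unfolding S_def
      by (intro sum.cong refl) (simp add: f_def cmod_power2, simp add: power2_eq_square)
    finally have "S \<le> norm (Abs_ell2 f) * K" using K(1)[of "Abs_ell2 f"] by simp
    then have "norm (Abs_ell2 f) * norm (Abs_ell2 f) \<le> K * norm (Abs_ell2 f)"
      using nf by (simp add: power2_eq_square mult.commute)
    then have "norm (Abs_ell2 f) \<le> K"
      using K(2) by (cases "norm (Abs_ell2 f) = 0") (auto simp: mult_le_cancel_right)
    then show ?thesis unfolding S_def[symmetric] nf[symmetric] by (intro power_mono) auto
  qed
  then have "summable (\<lambda>n. (cmod (y n))\<^sup>2)" by (intro summableI_nonneg_bounded) auto
  then have cy: "coord (Abs_ell2 y) = y" by (subst coord_Abs) (auto simp: ell2_seq_def y0)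
  have "\<phi> x = inner x (Abs_ell2 y)" for x
  proof (rule LIMSEQ_unique)
    show "(\<lambda>N. \<phi> (truncate N x)) \<longlonglongrightarrow> \<phi> x" by (rule \<phi>.tendsto[OF truncate_tendsto])
    show "(\<lambda>N. \<phi> (truncate N x)) \<longlonglongrightarrow> inner x (Abs_ell2 y)"
      unfolding \<phi>_truncate inner_ell2_suminf
      using summable_LIMSEQ[OF summable_Re_coord[of x "Abs_ell2 y"]] by (simp add: cy)
  qed
  then show ?thesis by blast
qed

lemma inner_adjoint:
  assumes "bounded_linear (T :: ell2 \<Rightarrow> ell2)"
  shows "inner (T x) y = inner x (adjoint T y)"
proof -
  have "\<exists>z. \<forall>x. inner (T x) y = inner x z" for y
    by (intro riesz_representation bounded_linear_compose[OF bounded_linear_inner_left assms])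
  then have "\<exists>T'. \<forall>x y. inner (T x) y = inner x (T' y)" by metis
  from someI_ex[OF this] show ?thesis unfolding adjoint_def by blast
qed

lemma bounded_linear_adjoint:
  assumes T: "bounded_linear (T :: ell2 \<Rightarrow> ell2)"
  shows "bounded_linear (adjoint T)"
proof -
  obtain K where K: "\<And>x. norm (T x) \<le> norm x * K" "K > 0" using bounded_linear.pos_bounded[OF T] by auto
  show ?thesis
  proof (rule bounded_linear_intro[where K = K])
    fix x y :: ell2 and r :: real
    show "adjoint T (x + y) = adjoint T x + adjoint T y"
      by (subst vector_eq_ldot[symmetric]) (simp add: inner_add_right flip: inner_adjoint[OF T])
    show "adjoint T (r *\<^sub>R x) = r *\<^sub>R adjoint T x"
      by (subst vector_eq_ldot[symmetric]) (simp flip: inner_adjoint[OF T])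
    let ?a = "adjoint T x"
    have "norm ?a * norm ?a = inner (T ?a) x"
      by (simp add: inner_adjoint[OF T] power2_norm_eq_inner flip: power2_eq_square)
    also have "\<dots> \<le> norm (T ?a) * norm x" by (rule norm_cauchy_schwarz)
    also have "\<dots> \<le> (norm ?a * K) * norm x" by (intro mult_right_mono K) auto
    finally have "norm ?a * norm ?a \<le> (norm x * K) * norm ?a" by (simp add: algebra_simps)
    then show "norm ?a \<le> norm x * K"
      using K(2) by (cases "norm ?a = 0") (auto simp: mult_le_cancel_right)
  qed
qed

text \<open>
  The finite combinations of basis vectors are dense, so at most one vector represents
  \<open>x \<mapsto> (L x, y)\<close> on \<open>D\<close>, and the definite description in \<open>adj_op\<close> denotes it.
\<close>

lemma inner_adj_op:
  assumes dense: "\<And>n z. basis n z \<in> D" and y: "y \<in> adj_dom D L" and x: "x \<in> D"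
  shows "inner (L x) y = inner x (adj_op D L y)"
proof -
  obtain z where z: "\<forall>x\<in>D. inner (L x) y = inner x z" using y by (auto simp: adj_dom_def)
  have "z' = z" if z': "\<forall>x\<in>D. inner (L x) y = inner x z'" for z'
  proof -
    have "inner (basis n c) (z' - z) = 0" for n c
      using z z' dense[of n c] by (simp add: inner_diff_right)
    then have "inner (truncate N (z' - z)) (z' - z) = 0" for N
      by (simp add: truncate_def inner_sum_left)
    moreover have "(\<lambda>N. inner (truncate N (z' - z)) (z' - z)) \<longlonglongrightarrow> inner (z' - z) (z' - z)"
      by (intro tendsto_intros truncate_tendsto)
    ultimately have "inner (z' - z) (z' - z) = 0" by (simp add: LIMSEQ_const_iff)
    then show ?thesis by simp
  qed
  then have "adj_op D L y = z" unfolding adj_op_def using z by (intro the_equality) blast+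
  then show ?thesis using z x by simp
qed


section \<open>Bochner integrals over bounded intervals\<close>

definition locally_integrable :: "(real \<Rightarrow> 'a::{banach, second_countable_topology}) \<Rightarrow> bool" where
  "locally_integrable h \<longleftrightarrow> (\<forall>T. set_integrable lborel {0..T} h)"

lemma locally_integrableD:
  assumes "locally_integrable h" "0 \<le> s"
  shows "set_integrable lborel {s..t} h"
  using assms by (intro set_integrable_subset[of lborel "{0..t}" h "{s..t}"])
    (auto simp: locally_integrable_def)

lemma locally_integrable_continuous:
  assumes "continuous_on {0..} h"
  shows "locally_integrable h"
  unfolding locally_integrable_def
  by (intro allI borel_integrable_atLeastAtMost' continuous_on_subset[OF assms]) auto

lemma set_integral_bounded_linear:
  assumes T: "bounded_linear T" and f: "set_integrable M A f"
  shows "set_integrable M A (\<lambda>x. T (f x))"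
    and "(LINT x:A|M. T (f x)) = T (LINT x:A|M. f x)"
proof -
  have eq: "indicator A x *\<^sub>R T (f x) = T (indicator A x *\<^sub>R f x)" for x
    using linear_scale[OF bounded_linear.linear[OF T]] by simp
  show "set_integrable M A (\<lambda>x. T (f x))"
    using integrable_bounded_linear[OF T] f unfolding set_integrable_def eq by blast
  show "(LINT x:A|M. T (f x)) = T (LINT x:A|M. f x)"
    using integral_bounded_linear[OF T] f
    unfolding set_integrable_def set_lebesgue_integral_def eq by blast
qed

lemma locally_integrable_bounded_linear:
  "bounded_linear T \<Longrightarrow> locally_integrable h \<Longrightarrow> locally_integrable (\<lambda>s. T (h s))"
  unfolding locally_integrable_def by (blast intro: set_integral_bounded_linear(1))

lemma locally_integrable_diff:
  "locally_integrable f \<Longrightarrow> locally_integrable g \<Longrightarrow> locally_integrable (\<lambda>s. f s - g s)"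
  unfolding locally_integrable_def by (blast intro: set_integral_diff(1))

lemma set_integral_interval_split:
  assumes "locally_integrable h" "0 \<le> s" "s \<le> t"
  shows "(LINT r:{0..t}|lborel. h r) = (LINT r:{0..s}|lborel. h r) + (LINT r:{s..t}|lborel. h r)"
proof -
  have "AE r in lborel. r \<noteq> s" by (rule AE_lborel_singleton)
  then have "AE r in lborel. \<not> (r \<in> {0..s} \<and> r \<in> {s..t})" by eventually_elim auto
  moreover have "{0..t} = {0..s} \<union> {s..t}" using assms by auto
  ultimately show ?thesis
    using set_integral_Un_AE[of "{0..s}" "{s..t}" lborel h] assms
    by (simp add: locally_integrableD)
qed

text \<open>
  Dominated convergence: as \<open>t\<close> varies, the indicator of \<open>[0, t]\<close> is discontinuous only at \<open>s = t\<close>,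
  which is a null set.
\<close>

lemma continuous_on_parametric_integral:
  fixes F :: "real \<Rightarrow> real \<Rightarrow> 'a::{banach, second_countable_topology}"
    and h :: "real \<Rightarrow> 'b::{banach, second_countable_topology}"
  assumes h: "locally_integrable h"
    and meas: "\<And>t. set_borel_measurable lborel {0..t} (F t)"
    and bound: "\<And>t s. 0 \<le> s \<Longrightarrow> s \<le> t \<Longrightarrow> norm (F t s) \<le> norm (h s)"
    and cont: "\<And>s. continuous_on {0..} (\<lambda>t. F t s)"
  shows "continuous_on {0..} (\<lambda>t. LINT s:{0..t}|lborel. F t s)"
proof (rule continuous_on_sequentiallyI)
  fix x :: "nat \<Rightarrow> real" and t
  assume x: "\<forall>n. x n \<in> {0..}" and t: "t \<in> {0..}" and lim: "x \<longlonglongrightarrow> t"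
  obtain T where T: "\<And>n. \<bar>x n\<bar> \<le> T"
    using convergent_imp_bounded[OF lim] by (auto simp: bounded_iff)
  show "(\<lambda>n. LINT s:{0..x n}|lborel. F (x n) s) \<longlonglongrightarrow> (LINT s:{0..t}|lborel. F t s)"
    unfolding set_lebesgue_integral_def
  proof (rule integral_dominated_convergence)
    show "integrable lborel (\<lambda>s. norm (indicator {0..T} s *\<^sub>R h s))"
      using h unfolding locally_integrable_def set_integrable_def by (intro integrable_norm) blast
    show "(\<lambda>s. indicator {0..t} s *\<^sub>R F t s) \<in> borel_measurable lborel"
      "(\<lambda>s. indicator {0..x n} s *\<^sub>R F (x n) s) \<in> borel_measurable lborel" for n
      using meas unfolding set_borel_measurable_def by blast+
    show "AE s in lborel. norm (indicator {0..x n} s *\<^sub>R F (x n) s) \<le> norm (indicator {0..T} s *\<^sub>R h s)" for n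
      using T[of n] bound by (intro AE_I2) (auto split: split_indicator)
    have "AE s in lborel. s \<noteq> t" by (rule AE_lborel_singleton)
    then show "AE s in lborel. (\<lambda>n. indicator {0..x n} s *\<^sub>R F (x n) s) \<longlonglongrightarrow> indicator {0..t} s *\<^sub>R F t s"
    proof eventually_elim
      case (elim s)
      have "(\<lambda>n. F (x n) s) \<longlonglongrightarrow> F t s"
        using cont[of s] x t lim by (auto simp: continuous_on_sequentially o_def)
      moreover have "(\<lambda>n. indicator {0..x n} s :: real) \<longlonglongrightarrow> indicator {0..t} s"
      proof (rule tendsto_eventually)
        show "\<forall>\<^sub>F n in sequentially. (indicator {0..x n} s :: real) = indicator {0..t} s"
        proof (cases "s < t")
          case True
          from order_tendstoD(1)[OF lim this] show ?thesis
            by eventually_elim (use True in \<open>auto split: split_indicator\<close>)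
        next
          case False
          then have "t < s" using elim by simp
          from order_tendstoD(2)[OF lim this] show ?thesis
            by eventually_elim (use \<open>t < s\<close> in \<open>auto split: split_indicator\<close>)
        qed
      qed
      ultimately show ?case by (intro tendsto_scaleR)
    qed
  qed
qed


section \<open>The diagonal semigroup and its Duhamel integral\<close>

text \<open>
  Extending the weights by their value at \<open>t = 0\<close> to negative times makes them contractive and
  continuous on the whole line, so that no case distinction enters the convolutions below.
\<close>

definition decay :: "(nat \<Rightarrow> real) \<Rightarrow> real \<Rightarrow> nat \<Rightarrow> real" where
  "decay \<mu> t n = exp (- \<mu> n * max 0 t)"

lemma contractive_decay: "(\<And>n. 0 \<le> \<mu> n) \<Longrightarrow> contractive_weights (decay \<mu> t)"
  by (simp add: contractive_weights_def decay_def)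

lemma continuous_on_decay:
  fixes S :: "real set"
  assumes "\<And>n. 0 \<le> \<mu> n" "continuous_on S \<tau>"
  shows "continuous_on S (\<lambda>t. diag (decay \<mu> (\<tau> t)) u)"
proof (rule continuous_on_sequentiallyI)
  fix x :: "nat \<Rightarrow> real" and a
  assume "\<forall>n. x n \<in> S" "a \<in> S" "x \<longlonglongrightarrow> a"
  then have \<tau>: "(\<lambda>n. \<tau> (x n)) \<longlonglongrightarrow> \<tau> a"
    using assms(2) by (auto simp: continuous_on_sequentially o_def)
  show "(\<lambda>n. diag (decay \<mu> (\<tau> (x n))) u) \<longlonglongrightarrow> diag (decay \<mu> (\<tau> a)) u"
    by (intro diag_tendsto contractive_decay assms) (unfold decay_def, intro tendsto_intros \<tau>)
qed

definition duhamel :: "(nat \<Rightarrow> real) \<Rightarrow> (real \<Rightarrow> ell2) \<Rightarrow> real \<Rightarrow> ell2" where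
  "duhamel \<mu> h t = (LINT s:{0..t}|lborel. diag (decay \<mu> (t - s)) (h s))"

context
  fixes \<mu> :: "nat \<Rightarrow> real" and h :: "real \<Rightarrow> ell2"
  assumes \<mu>: "\<And>n. 0 \<le> \<mu> n" and h: "locally_integrable h"
begin

lemma duhamel_integrand_measurable:
  "set_borel_measurable lborel {0..t} (\<lambda>s. diag (decay \<mu> (t - s)) (h s))"
proof -
  have [measurable]: "(\<lambda>s. indicator {0..t} s *\<^sub>R h s) \<in> borel_measurable lborel"
    using h unfolding locally_integrable_def set_integrable_def by (blast intro: borel_measurable_integrable)
  have "(\<lambda>s. diag (decay \<mu> (t - s)) (indicator {0..t} s *\<^sub>R h s)) \<in> borel_measurable lborel"
  proof (rule borel_measurable_ell2I)
    fix n
    have "coord (diag (decay \<mu> (t - s)) (indicator {0..t} s *\<^sub>R h s)) n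
        = of_real (decay \<mu> (t - s) n) * coord (indicator {0..t} s *\<^sub>R h s) n" for s
      by (rule coord_diag[OF contractive_decay[OF \<mu>]])
    moreover have "(\<lambda>s. of_real (decay \<mu> (t - s) n) * coord (indicator {0..t} s *\<^sub>R h s) n)
        \<in> borel_measurable lborel"
      unfolding decay_def by measurable
    ultimately show "(\<lambda>s. coord (diag (decay \<mu> (t - s)) (indicator {0..t} s *\<^sub>R h s)) n)
        \<in> borel_measurable lborel"
      by simp
  qed
  then show ?thesis
    unfolding set_borel_measurable_def by (simp add: diag_scaleR[OF contractive_decay[OF \<mu>]])
qed

lemma duhamel_integrable: "set_integrable lborel {0..t} (\<lambda>s. diag (decay \<mu> (t - s)) (h s))"
  by (rule set_integrable_bound[of lborel _ h, OF _ duhamel_integrand_measurable])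
    (use h in \<open>auto simp: locally_integrable_def norm_diag_le[OF contractive_decay[OF \<mu>]]\<close>)

lemma norm_duhamel_le: "norm (duhamel \<mu> h t) \<le> (LINT s:{0..t}|lborel. norm (h s))"
proof -
  have "norm (duhamel \<mu> h t) \<le> (LINT s:{0..t}|lborel. norm (diag (decay \<mu> (t - s)) (h s)))"
    unfolding duhamel_def by (rule set_integral_norm_bound[OF duhamel_integrable])
  also have "\<dots> \<le> (LINT s:{0..t}|lborel. norm (h s))"
    by (intro set_integral_mono set_integrable_norm duhamel_integrable)
      (use h in \<open>auto simp: locally_integrable_def norm_diag_le[OF contractive_decay[OF \<mu>]] intro: set_integrable_norm\<close>)
  finally show ?thesis .
qed

lemma continuous_on_duhamel: "continuous_on {0..} (duhamel \<mu> h)"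
proof -
  have "continuous_on {0..} (\<lambda>t. duhamel \<mu> h t)"
    unfolding duhamel_def
    by (rule continuous_on_parametric_integral[OF h duhamel_integrand_measurable])
      (auto intro!: norm_diag_le contractive_decay \<mu> continuous_on_decay continuous_intros)
  then show ?thesis by simp
qed

lemma coord_duhamel:
  "coord (duhamel \<mu> h t) n = (LINT s:{0..t}|lborel. of_real (exp (- \<mu> n * (t - s))) * coord (h s) n)"
proof -
  have "coord (duhamel \<mu> h t) n = (LINT s:{0..t}|lborel. coord (diag (decay \<mu> (t - s)) (h s)) n)"
    unfolding duhamel_def
    by (rule set_integral_bounded_linear(2)[OF bounded_linear_coord duhamel_integrable, symmetric])
  also have "\<dots> = (LINT s:{0..t}|lborel. of_real (exp (- \<mu> n * (t - s))) * coord (h s) n)"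
    by (rule set_lebesgue_integral_cong) (auto simp: coord_diag[OF contractive_decay[OF \<mu>]] decay_def)
  finally show ?thesis .
qed

end

lemma duhamel_diff:
  assumes "\<And>n. 0 \<le> \<mu> n" "locally_integrable h" "locally_integrable h'"
  shows "duhamel \<mu> h t - duhamel \<mu> h' t = duhamel \<mu> (\<lambda>s. h s - h' s) t"
  unfolding duhamel_def
  by (simp add: diag_diff contractive_decay assms duhamel_integrable flip: set_integral_diff(2))

lemma integral_exp_decay:
  fixes m :: real
  assumes "s \<le> t"
  shows "(LINT r:{s..t}|lborel. m * exp (- m * (r - s))) = 1 - exp (- m * (t - s))"
  unfolding set_lebesgue_integral_def
  by (subst integral_FTC_atLeastAtMost[where F = "\<lambda>r. - exp (- m * (r - s))"])
    (auto intro!: assms derivative_eq_intros continuous_intros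
      simp flip: has_real_derivative_iff_has_vector_derivative)

text \<open>
  After exchanging the integrals, the inner one runs over \<open>s \<le> r \<le> t\<close> and equals
  \<open>1 - exp (- m (t - s))\<close>. This is the integrated form of the scalar equation \<open>y' + m y = f\<close>.
\<close>

lemma integral_convolution_exp:
  fixes f :: "real \<Rightarrow> complex" and m :: real
  assumes m: "0 \<le> m" and f: "set_integrable lborel {0..t} f"
  shows "of_real m * (LINT r:{0..t}|lborel. LINT s:{0..r}|lborel. of_real (exp (- m * (r - s))) * f s)
    = (LINT s:{0..t}|lborel. f s) - (LINT s:{0..t}|lborel. of_real (exp (- m * (t - s))) * f s)"
proof -
  define \<phi> where "\<phi> s = indicator {0..t} s *\<^sub>R f s" for s
  have \<phi>: "integrable lborel \<phi>" using f unfolding \<phi>_def set_integrable_def .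
  then have [measurable]: "\<phi> \<in> borel_measurable lborel" by simp
  define e where "e r s = (if s \<le> r \<and> r \<le> t \<and> 0 \<le> r then exp (- m * (r - s)) else 0)" for r s :: real
  have e: "0 \<le> e r s" "e r s \<le> indicator {0..t} r" for r s
    using m by (auto simp: e_def split: split_indicator intro!: mult_nonneg_nonneg)
  have P: "integrable (lborel \<Otimes>\<^sub>M lborel) (\<lambda>(r, s). indicator {0..t} r *\<^sub>R \<phi> s)"
  proof (rule lborel_pair.Fubini_integrable)
    show "AE r in lborel. integrable lborel (\<lambda>s. case (r, s) of (r, s) \<Rightarrow> indicator {0..t} r *\<^sub>R \<phi> s)"
      using \<phi> by (auto intro: integrable_scaleR_right)
    have "integrable lborel (\<lambda>r. indicator {0..t} r *\<^sub>R (LINT s|lborel. norm (\<phi> s)))"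
      by (intro integrable_scaleR_left integrable_real_indicator) (auto simp: emeasure_lborel_Icc_eq)
    then show "integrable lborel (\<lambda>r. LINT s|lborel. norm (case (r, s) of (r, s) \<Rightarrow> indicator {0..t} r *\<^sub>R \<phi> s))"
      by simp
  qed measurable
  have I: "integrable (lborel \<Otimes>\<^sub>M lborel) (\<lambda>(r, s). e r s *\<^sub>R \<phi> s)"
  proof (rule Bochner_Integration.integrable_bound[OF P])
    show "(\<lambda>(r, s). e r s *\<^sub>R \<phi> s) \<in> borel_measurable (lborel \<Otimes>\<^sub>M lborel)"
      unfolding e_def by measurable
    show "AE x in lborel \<Otimes>\<^sub>M lborel. norm (case x of (r, s) \<Rightarrow> e r s *\<^sub>R \<phi> s)
        \<le> norm (case x of (r, s) \<Rightarrow> indicator {0..t} r *\<^sub>R \<phi> s)"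
      using e by (intro AE_I2) (auto intro!: mult_right_mono)
  qed
  have "(LINT r:{0..t}|lborel. LINT s:{0..r}|lborel. of_real (exp (- m * (r - s))) * f s)
      = (LINT r|lborel. LINT s|lborel. e r s *\<^sub>R \<phi> s)"
    unfolding set_lebesgue_integral_def
  proof (rule Bochner_Integration.integral_cong[OF refl])
    fix r :: real
    show "indicator {0..t} r *\<^sub>R (LINT s|lborel. indicator {0..r} s *\<^sub>R (of_real (exp (- m * (r - s))) * f s))
        = (LINT s|lborel. e r s *\<^sub>R \<phi> s)"
    proof (cases "r \<in> {0..t}")
      case True
      then have "(\<lambda>s. indicator {0..r} s *\<^sub>R (of_real (exp (- m * (r - s))) * f s)) = (\<lambda>s. e r s *\<^sub>R \<phi> s)"
        by (auto simp: fun_eq_iff e_def \<phi>_def scaleR_conv_of_real split: split_indicator)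
      then show ?thesis using True by simp
    next
      case False
      then have "(\<lambda>s. e r s *\<^sub>R \<phi> s) = (\<lambda>s. 0)" by (auto simp: fun_eq_iff e_def)
      then show ?thesis using False by simp
    qed
  qed
  also have "\<dots> = (LINT s|lborel. LINT r|lborel. e r s *\<^sub>R \<phi> s)"
    by (rule lborel_pair.Fubini_integral[OF I, symmetric])
  finally have "of_real m * (LINT r:{0..t}|lborel. LINT s:{0..r}|lborel. of_real (exp (- m * (r - s))) * f s)
      = (LINT s|lborel. of_real m * (LINT r|lborel. e r s *\<^sub>R \<phi> s))"
    by simp
  also have "\<dots> = (LINT s|lborel. indicator {0..t} s *\<^sub>R (f s - of_real (exp (- m * (t - s))) * f s))"
  proof (rule Bochner_Integration.integral_cong[OF refl])
    fix s :: real
    show "of_real m * (LINT r|lborel. e r s *\<^sub>R \<phi> s)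
        = indicator {0..t} s *\<^sub>R (f s - of_real (exp (- m * (t - s))) * f s)"
    proof (cases "s \<in> {0..t}")
      case True
      have "of_real m * (LINT r|lborel. e r s *\<^sub>R \<phi> s) = m *\<^sub>R (LINT r|lborel. e r s *\<^sub>R \<phi> s)"
        by (simp only: scaleR_conv_of_real)
      also have "\<dots> = (LINT r|lborel. m *\<^sub>R (e r s *\<^sub>R \<phi> s))"
        by (rule integral_scaleR_right[symmetric])
      also have "(\<lambda>r. m *\<^sub>R (e r s *\<^sub>R \<phi> s)) = (\<lambda>r. (m * e r s) *\<^sub>R f s)"
        using True by (simp add: \<phi>_def)
      also have "(\<lambda>r. (m * e r s) *\<^sub>R f s) = (\<lambda>r. (indicator {s..t} r *\<^sub>R (m * exp (- m * (r - s)))) *\<^sub>R f s)"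
        using True by (auto simp: fun_eq_iff e_def split: split_indicator)
      also have "(LINT r|lborel. (indicator {s..t} r *\<^sub>R (m * exp (- m * (r - s)))) *\<^sub>R f s)
          = (LINT r|lborel. indicator {s..t} r *\<^sub>R (m * exp (- m * (r - s)))) *\<^sub>R f s"
      proof (rule integral_scaleR_left)
        have "set_integrable lborel {s..t} (\<lambda>r. m * exp (- m * (r - s)))"
          by (intro borel_integrable_atLeastAtMost' continuous_intros)
        then show "integrable lborel (\<lambda>r. indicator {s..t} r *\<^sub>R (m * exp (- m * (r - s))))"
          by (simp add: set_integrable_def)
      qed
      also have "\<dots> = (1 - exp (- m * (t - s))) *\<^sub>R f s"
        using True by (simp only: integral_exp_decay[of s t m, unfolded set_lebesgue_integral_def] atLeastAtMost_iff)
      finally show ?thesis using True by (simp add: scaleR_conv_of_real algebra_simps)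
    next
      case False
      then show ?thesis by (simp add: \<phi>_def)
    qed
  qed
  also have "\<dots> = (LINT s:{0..t}|lborel. f s) - (LINT s:{0..t}|lborel. of_real (exp (- m * (t - s))) * f s)"
    unfolding set_lebesgue_integral_def[symmetric]
  proof (rule set_integral_diff(2)[OF f])
    show "set_integrable lborel {0..t} (\<lambda>s. of_real (exp (- m * (t - s))) * f s)"
    proof (rule set_integrable_bound[OF f])
      have "(\<lambda>s. of_real (exp (- m * (t - s))) * \<phi> s) \<in> borel_measurable lborel" by measurable
      then show "set_borel_measurable lborel {0..t} (\<lambda>s. of_real (exp (- m * (t - s))) * f s)"
        by (simp add: set_borel_measurable_def \<phi>_def)
      show "AE s in lborel. s \<in> {0..t} \<longrightarrow> norm (of_real (exp (- m * (t - s))) * f s) \<le> norm (f s)"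
        using m by (intro AE_I2 impI) (auto simp: norm_mult intro!: mult_left_le_one_le)
    qed
  qed
  finally show ?thesis .
qed

text \<open>
  Each coordinate solves a scalar linear equation. That the primitive of the solution lies in the
  domain is then automatic, because \<open>\<mu>\<^sub>n\<close> times its coordinates is a difference of coordinates
  of elements of the space.
\<close>

lemma diagonal_mild_solution:
  assumes \<mu>: "\<And>n. 0 \<le> \<mu> n" and h: "locally_integrable h"
    and m: "\<And>t. 0 \<le> t \<Longrightarrow> m t = diag (decay \<mu> t) u0 + duhamel \<mu> h t"
  shows "solves (diag_dom \<mu>) (diag \<mu>) h u0 m"
proof -
  have "continuous_on {0..} (\<lambda>t. diag (decay \<mu> t) u0 + duhamel \<mu> h t)"
    by (intro continuous_intros continuous_on_decay[where \<tau> = "\<lambda>t. t"] \<mu>) (rule continuous_on_duhamel[OF \<mu> h])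
  then have cont: "continuous_on {0..} m"
    by (rule continuous_on_eq) (simp add: m)
  note li = locally_integrableD[OF locally_integrable_continuous[OF cont] order_refl]
  have key: "of_real (\<mu> n) * coord (LINT s:{0..t}|lborel. m s) n
      = coord (u0 + (LINT s:{0..t}|lborel. h s) - m t) n" if t: "0 \<le> t" for t n
  proof -
    let ?E = "\<lambda>s. of_real (exp (- \<mu> n * s)) * coord u0 n :: complex"
    let ?G = "\<lambda>r. LINT s:{0..r}|lborel. of_real (exp (- \<mu> n * (r - s))) * coord (h s) n"
    have co: "coord (m r) n = ?E r + ?G r" if "0 \<le> r" for r
      by (simp only: m[OF that] coord_add coord_duhamel[OF \<mu> h] coord_diag[OF contractive_decay[OF \<mu>]])
        (simp add: decay_def that)
    have "continuous_on {0..} (\<lambda>r. coord (duhamel \<mu> h r) n)"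
      by (rule continuous_on_compose2[OF linear_continuous_on[OF bounded_linear_coord] continuous_on_duhamel[OF \<mu> h]]) auto
    moreover have "(\<lambda>r. coord (duhamel \<mu> h r) n) = ?G"
      by (rule ext) (rule coord_duhamel[OF \<mu> h])
    ultimately have "continuous_on {0..} ?G" by (rule back_subst[where P = "continuous_on {0..}"])
    note G = locally_integrableD[OF locally_integrable_continuous[OF this] order_refl, of t]
    have E: "set_integrable lborel {0..t} ?E"
      by (intro borel_integrable_atLeastAtMost' continuous_intros)
    note hn = set_integral_bounded_linear[OF bounded_linear_coord locally_integrableD[OF h order_refl, of t], of n]
    have "of_real (\<mu> n) * (LINT s:{0..t}|lborel. ?E s)
        = of_real (\<mu> n) * (LINT s:{0..t}|lborel. complex_of_real (exp (- \<mu> n * s))) * coord u0 n"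
      by (simp only: set_integral_mult_left mult.assoc)
    also have "of_real (\<mu> n) * (LINT s:{0..t}|lborel. complex_of_real (exp (- \<mu> n * s)))
        = of_real (LINT s:{0..t}|lborel. \<mu> n * exp (- \<mu> n * s))"
      by (simp only: set_integral_complex_of_real set_integral_mult_right of_real_mult)
    also have "(LINT s:{0..t}|lborel. \<mu> n * exp (- \<mu> n * s)) = 1 - exp (- \<mu> n * t)"
      using integral_exp_decay[OF t, of "\<mu> n"] by (simp only: diff_zero)
    finally have intE: "of_real (\<mu> n) * (LINT s:{0..t}|lborel. ?E s) = coord u0 n - ?E t"
      by (simp add: algebra_simps)
    have "coord (LINT s:{0..t}|lborel. m s) n = (LINT s:{0..t}|lborel. coord (m s) n)"
      by (rule set_integral_bounded_linear(2)[OF bounded_linear_coord li, symmetric])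
    also have "\<dots> = (LINT s:{0..t}|lborel. ?E s + ?G s)"
      by (rule set_lebesgue_integral_cong) (auto simp: co)
    also have "\<dots> = (LINT s:{0..t}|lborel. ?E s) + (LINT s:{0..t}|lborel. ?G s)"
      by (rule set_integral_add(2)[OF E G])
    finally have "of_real (\<mu> n) * coord (LINT s:{0..t}|lborel. m s) n
        = of_real (\<mu> n) * (LINT s:{0..t}|lborel. ?E s) + of_real (\<mu> n) * (LINT s:{0..t}|lborel. ?G s)"
      by (simp only: distrib_left)
    also have "\<dots> = (coord u0 n - ?E t) + (coord (LINT s:{0..t}|lborel. h s) n - ?G t)"
      by (simp only: intE integral_convolution_exp[OF \<mu> hn(1)] hn(2))
    finally show ?thesis by (simp add: co[OF t])
  qed
  have "(LINT s:{0..t}|lborel. m s) \<in> diag_dom \<mu>" if "0 \<le> t" for t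
    unfolding diag_dom_def mem_Collect_eq key[OF that] by (rule coord)
  then show ?thesis
    unfolding solves_def using cont
    by (auto intro!: ell2_eqI simp: coord_diag_dom key)
qed


section \<open>Well-posedness for bounded perturbations of diagonal operators\<close>

lemma integral_exp_growth_le:
  fixes \<omega> c :: real
  assumes "0 < \<omega>" "0 \<le> c" "0 \<le> t"
  shows "(LINT s:{0..t}|lborel. exp (\<omega> * s) * c) \<le> exp (\<omega> * t) / \<omega> * c"
proof -
  have "- \<omega> * (LINT s:{0..t}|lborel. exp (\<omega> * s)) = 1 - exp (\<omega> * t)"
    using integral_exp_decay[OF assms(3), of "- \<omega>"]
    by (simp only: set_integral_mult_right minus_minus diff_zero)
  then have "(LINT s:{0..t}|lborel. exp (\<omega> * s)) = (exp (\<omega> * t) - 1) / \<omega>"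
    using assms(1) by (simp add: field_simps)
  then have "(LINT s:{0..t}|lborel. exp (\<omega> * s) * c) = (exp (\<omega> * t) - 1) / \<omega> * c"
    by (simp only: set_integral_mult_left)
  also have "\<dots> \<le> exp (\<omega> * t) / \<omega> * c"
    using assms by (intro mult_right_mono divide_right_mono) auto
  finally show ?thesis .
qed

text \<open>
  If \<open>M\<close> bounds \<open>K\<close>, the Duhamel map for \<open>z(t) = exp (- 2Mt) u(t)\<close> is a contraction with constant
  \<open>1/2\<close> on the bounded continuous functions on the whole half line, because
  \<open>M \<integral> exp (2Ms) ds \<le> exp (2Mt) / 2\<close> over \<open>[0, t]\<close>. The weight also absorbs the linear growth
  allowed for the integrated forcing term. Negative times are mapped to \<open>0\<close>, so that the
  functions live on all of \<open>\<real>\<close>.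
\<close>

lemma exists_perturbed_solution:
  assumes \<mu>: "\<And>n. 0 \<le> \<mu> n" and K: "bounded_linear K" and g: "locally_integrable g" and N: "0 \<le> N"
    and growth: "\<And>t. 0 \<le> t \<Longrightarrow> (LINT s:{0..t}|lborel. norm (g s)) \<le> N + t"
  shows "\<exists>u. solves (diag_dom \<mu>) (\<lambda>x. diag \<mu> x + K x) g u0 u"
proof -
  obtain M where M: "\<And>x. norm (K x) \<le> norm x * M" "0 < M" using bounded_linear.pos_bounded[OF K] by auto
  define \<omega> where "\<omega> = 2 * M"
  have \<omega>: "0 < \<omega>" using M by (simp add: \<omega>_def)
  define force where "force z s = g s - exp (\<omega> * s) *\<^sub>R K (apply_bcontfun z s)" for z s
  define mild where "mild z t = diag (decay \<mu> t) u0 + duhamel \<mu> (force z) t" for z t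
  define \<Psi> where "\<Psi> z t = exp (- \<omega> * max 0 t) *\<^sub>R mild z (max 0 t)" for z t
  have cK: "continuous_on S (\<lambda>s. exp (\<omega> * s) *\<^sub>R K (apply_bcontfun z s))" for S z
    by (intro continuous_intros continuous_on_compose2[OF linear_continuous_on[OF K] continuous_on_apply_bcontfun]) auto
  have force: "locally_integrable (force z)" for z
    unfolding force_def by (intro locally_integrable_diff g locally_integrable_continuous cK)
  have normK: "norm (exp (\<omega> * s) *\<^sub>R K x) \<le> exp (\<omega> * s) * (M * b)" if "norm x \<le> b" for s x b
  proof -
    have "norm (K x) \<le> M * b" 
      using M(1)[of x] mult_right_mono[OF that less_imp_le[OF M(2)]] by (simp add: mult.commute)
    then show ?thesis by simp
  qed
  have expi: "set_integrable lborel {0..t} (\<lambda>s. exp (\<omega> * s) * c)" for t c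
    by (intro borel_integrable_atLeastAtMost' continuous_intros)
  have cont: "continuous_on {0..} (mild z)" for z
    unfolding mild_def
    by (intro continuous_intros continuous_on_decay[where \<tau> = "\<lambda>t. t"] \<mu> continuous_on_duhamel force)
  have bcont: "\<Psi> z \<in> bcontfun" for z
  proof (rule bcontfun_normI)
    have "continuous_on UNIV (\<lambda>t. \<Psi> z t)"
      unfolding \<Psi>_def by (intro continuous_intros continuous_on_compose2[OF cont]) auto
    then show "continuous_on UNIV (\<Psi> z)" by simp
    fix t :: real
    define \<tau> where "\<tau> = max 0 t"
    have \<tau>: "0 \<le> \<tau>" by (simp add: \<tau>_def)
    let ?c = "M * norm z"
    have "norm (mild z \<tau>) \<le> norm u0 + norm (duhamel \<mu> (force z) \<tau>)"
      unfolding mild_def by (intro norm_triangle_mono norm_diag_le contractive_decay \<mu> order_refl)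
    also have "norm (duhamel \<mu> (force z) \<tau>) \<le> (LINT s:{0..\<tau>}|lborel. norm (force z s))"
      by (intro norm_duhamel_le \<mu> force)
    also have "\<dots> \<le> (LINT s:{0..\<tau>}|lborel. norm (g s) + exp (\<omega> * s) * ?c)"
    proof (intro set_integral_mono set_integral_add set_integrable_norm expi)
      show "norm (force z s) \<le> norm (g s) + exp (\<omega> * s) * ?c" for s
        unfolding force_def
        by (intro norm_triangle_le_diff add_mono order_refl normK norm_bounded)
    qed (use force g in \<open>auto simp: locally_integrable_def\<close>)
    also have "\<dots> = (LINT s:{0..\<tau>}|lborel. norm (g s)) + (LINT s:{0..\<tau>}|lborel. exp (\<omega> * s) * ?c)"
      by (intro set_integral_add set_integrable_norm expi) (use g in \<open>auto simp: locally_integrable_def\<close>)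
    also have "\<dots> \<le> (N + \<tau>) + exp (\<omega> * \<tau>) / \<omega> * ?c"
      using M(2) by (intro add_mono growth integral_exp_growth_le \<omega> \<tau>) auto
    finally have "exp (- \<omega> * \<tau>) * norm (mild z \<tau>)
        \<le> exp (- \<omega> * \<tau>) * (norm u0 + ((N + \<tau>) + exp (\<omega> * \<tau>) / \<omega> * ?c))"
      by (intro mult_left_mono) auto
    also have "\<dots> = exp (- \<omega> * \<tau>) * (norm u0 + N) + exp (- \<omega> * \<tau>) * \<tau> + ?c / \<omega>"
      using \<omega> by (simp add: algebra_simps exp_minus)
    also have "\<dots> \<le> 1 * (norm u0 + N) + 1 / \<omega> + ?c / \<omega>"
    proof (intro add_mono mult_right_mono order_refl)
      show "exp (- \<omega> * \<tau>) \<le> 1" using \<omega> \<tau> by simp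
      have "\<omega> * \<tau> \<le> exp (\<omega> * \<tau>)" using exp_ge_add_one_self[of "\<omega> * \<tau>"] by linarith
      then show "exp (- \<omega> * \<tau>) * \<tau> \<le> 1 / \<omega>" using \<omega> by (simp add: exp_minus field_simps)
    qed (use N in simp)
    finally show "norm (\<Psi> z t) \<le> 1 * (norm u0 + N) + 1 / \<omega> + ?c / \<omega>"
      by (simp add: \<Psi>_def \<tau>_def)
  qed
  have contract: "dist (Bcontfun (\<Psi> z)) (Bcontfun (\<Psi> z')) \<le> 1 / 2 * dist z z'" for z z'
  proof (rule dist_bound)
    fix t :: real
    define \<tau> where "\<tau> = max 0 t"
    have \<tau>: "0 \<le> \<tau>" by (simp add: \<tau>_def)
    let ?c = "M * dist z z'"
    have "norm (mild z \<tau> - mild z' \<tau>) = norm (duhamel \<mu> (\<lambda>s. force z s - force z' s) \<tau>)"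
      by (simp add: mild_def flip: duhamel_diff[OF \<mu> force force])
    also have "\<dots> \<le> (LINT s:{0..\<tau>}|lborel. norm (force z s - force z' s))"
      by (intro norm_duhamel_le \<mu> force locally_integrable_diff)
    also have "\<dots> \<le> (LINT s:{0..\<tau>}|lborel. exp (\<omega> * s) * ?c)"
    proof (intro set_integral_mono set_integrable_norm expi)
      show "set_integrable lborel {0..\<tau>} (\<lambda>s. force z s - force z' s)"
        using locally_integrable_diff[OF force force] by (simp add: locally_integrable_def)
      fix s
      have "force z s - force z' s = exp (\<omega> * s) *\<^sub>R K (apply_bcontfun z' s - apply_bcontfun z s)"
        by (simp add: force_def linear_diff[OF bounded_linear.linear[OF K]] scaleR_diff_right)
      then show "norm (force z s - force z' s) \<le> exp (\<omega> * s) * ?c"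
        using normK[of "apply_bcontfun z' s - apply_bcontfun z s" "dist z z'" s] dist_bounded[of z s z']
        by (simp add: dist_norm norm_minus_commute)
    qed
    also have "\<dots> \<le> exp (\<omega> * \<tau>) / \<omega> * ?c"
      using M(2) by (intro integral_exp_growth_le \<omega> \<tau>) auto
    finally have "exp (- \<omega> * \<tau>) * norm (mild z \<tau> - mild z' \<tau>) \<le> exp (- \<omega> * \<tau>) * (exp (\<omega> * \<tau>) / \<omega> * ?c)"
      by (intro mult_left_mono) auto
    also have "\<dots> = 1 / 2 * dist z z'"
      using M(2) by (simp add: exp_minus \<omega>_def)
    finally show "dist (apply_bcontfun (Bcontfun (\<Psi> z)) t) (apply_bcontfun (Bcontfun (\<Psi> z')) t) \<le> 1 / 2 * dist z z'"
      by (simp add: Bcontfun_inverse bcont dist_norm \<Psi>_def \<tau>_def flip: scaleR_diff_right)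
  qed
  obtain z where z: "Bcontfun (\<Psi> z) = z"
    using banach_fix_type[of "1 / 2" "\<lambda>z. Bcontfun (\<Psi> z)"] contract by auto
  define u where "u t = exp (\<omega> * t) *\<^sub>R apply_bcontfun z t" for t
  have "apply_bcontfun z t = \<Psi> z t" for t
    using z Bcontfun_inverse[OF bcont[of z]] by simp
  then have u: "u t = mild z t" if "0 \<le> t" for t
    using that by (simp add: u_def \<Psi>_def flip: exp_add)
  have force_u: "force z = (\<lambda>s. g s - K (u s))"
    by (simp add: fun_eq_iff force_def u_def linear_scale[OF bounded_linear.linear[OF K]])
  have S: "solves (diag_dom \<mu>) (diag \<mu>) (force z) u0 u"
    by (rule diagonal_mild_solution[OF \<mu> force]) (simp add: u mild_def)
  then have uc: "locally_integrable u"
    by (intro locally_integrable_continuous) (simp add: solves_def)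
  have int_force: "(LINT s:{0..t}|lborel. force z s)
      = (LINT s:{0..t}|lborel. g s) - K (LINT s:{0..t}|lborel. u s)" for t
    using set_integral_diff(2)[OF locally_integrableD[OF g order_refl]
        set_integral_bounded_linear(1)[OF K locally_integrableD[OF uc order_refl]], of t]
      set_integral_bounded_linear(2)[OF K locally_integrableD[OF uc order_refl], of t]
    unfolding force_u by simp
  have "solves (diag_dom \<mu>) (\<lambda>x. diag \<mu> x + K x) g u0 u"
    using S unfolding solves_def int_force by (auto simp flip: add.assoc)
  then show ?thesis by blast
qed

text \<open>
  Both integrals commute with the functionals \<open>(x, -)\<close>, which reduces the claim to real-valued functions.
  It makes the fundamental theorem of calculus available for the integrals in \<open>solves\<close>.
\<close>

lemma interval_integral_eq_henstock:
  fixes u :: "real \<Rightarrow> ell2"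
  assumes u: "continuous_on {a..b} u"
  shows "(LINT s:{a..b}|lborel. u s) = integral {a..b} u"
proof -
  have i: "set_integrable lborel {a..b} u" by (rule borel_integrable_atLeastAtMost'[OF u])
  have "inner x (LINT s:{a..b}|lborel. u s) = inner x (integral {a..b} u)" for x
  proof -
    have "inner x (LINT s:{a..b}|lborel. u s) = (LINT s:{a..b}|lborel. inner x (u s))"
      by (rule set_integral_bounded_linear(2)[OF bounded_linear_inner_right i, symmetric])
    also have "\<dots> = integral {a..b} (\<lambda>s. inner x (u s))"
      by (rule set_borel_integral_eq_integral(2)[OF set_integral_bounded_linear(1)[OF bounded_linear_inner_right i]])
    also have "\<dots> = inner x (integral {a..b} u)"
      using integral_linear[OF integrable_continuous_interval[OF u] bounded_linear_inner_right[of x]]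
      by (simp add: o_def)
    finally show ?thesis .
  qed
  then show ?thesis using vector_eq_ldot by blast
qed

lemma primitive_has_derivative:
  fixes u :: "real \<Rightarrow> ell2"
  assumes u: "continuous_on {0..} u" and t: "0 \<le> t" "t \<le> T"
  shows "((\<lambda>t. LINT s:{0..t}|lborel. u s) has_vector_derivative u t) (at t within {0..T})"
proof -
  have c: "continuous_on {0..r} u" for r by (rule continuous_on_subset[OF u]) auto
  have "((\<lambda>t. integral {0..t} u) has_vector_derivative u t) (at t within {0..T})"
    by (rule integral_has_vector_derivative[OF c]) (use t in auto)
  then show ?thesis by (simp add: interval_integral_eq_henstock c)
qed

text \<open>
  The difference \<open>d\<close> of two solutions need not lie in the domain, but its primitive \<open>V\<close> does and satisfies
  \<open>V' + diag \<mu> V + K V = 0\<close> in the classical sense, with \<open>V(0) = 0\<close>. Since the diagonal part is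
  nonnegative, \<open>exp (- 2Mt) |V|\<^sup>2\<close> does not increase, where \<open>M\<close> bounds \<open>K\<close>.
\<close>

lemma perturbed_solution_unique:
  assumes \<mu>: "\<And>n. 0 \<le> \<mu> n" and K: "bounded_linear K"
    and u: "solves (diag_dom \<mu>) (\<lambda>x. diag \<mu> x + K x) g u0 u"
    and v: "solves (diag_dom \<mu>) (\<lambda>x. diag \<mu> x + K x) g u0 v"
    and t: "0 \<le> t"
  shows "u t = v t"
proof -
  obtain M where M: "\<And>x. norm (K x) \<le> norm x * M" "0 < M" using bounded_linear.pos_bounded[OF K] by auto
  define d where "d t = u t - v t" for t
  define V where "V t = (LINT s:{0..t}|lborel. d s)" for t
  have c: "continuous_on {0..} u" "continuous_on {0..} v" "continuous_on {0..} d"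
    using u v unfolding d_def solves_def by (auto intro: continuous_on_diff)
  have li: "locally_integrable u" "locally_integrable v" by (intro locally_integrable_continuous c)+
  have Vsplit: "V t = (LINT s:{0..t}|lborel. u s) - (LINT s:{0..t}|lborel. v s)" for t
    unfolding V_def d_def using li by (intro set_integral_diff) (auto simp: locally_integrable_def)
  have V: "V s \<in> diag_dom \<mu>" "d s = - (diag \<mu> (V s) + K (V s))" if "0 \<le> s" for s
    using u v that unfolding solves_def Vsplit d_def
    by (auto simp: diag_dom_diff linear_diff[OF bounded_linear.linear[OF K]] algebra_simps dest!: spec[of _ s] intro!: diag_dom_diff)
  have V0: "V 0 = 0"
    using interval_integral_eq_henstock[of 0 0 d] by (simp add: V_def)
  define q where "q s = exp (- 2 * M * s) * inner (V s) (V s)" for s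
  have "q t \<le> q 0"
  proof (cases "t = 0")
    case False
    have cV: "continuous_on {0..t} V"
      unfolding V_def by (rule continuous_on_vector_derivative[OF primitive_has_derivative[OF c(3)]]) auto
    show ?thesis
    proof (rule DERIV_nonpos_imp_decreasing_open[of 0 t q])
      fix s assume s: "0 < s" "s < t"
      have "(V has_vector_derivative d s) (at s)"
        using primitive_has_derivative[OF c(3), of s t] s by (simp add: at_within_Icc_at flip: V_def)
      then have "(q has_real_derivative exp (- 2 * M * s) * (2 * inner (V s) (d s) - 2 * M * inner (V s) (V s))) (at s)"
        unfolding q_def has_real_derivative_iff_has_vector_derivative has_vector_derivative_def
        by (auto intro!: derivative_eq_intros simp: inner_commute algebra_simps)
      moreover have "inner (V s) (d s) \<le> M * inner (V s) (V s)"
      proof -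
        have "- inner (V s) (K (V s)) \<le> norm (V s) * norm (K (V s))"
          using norm_cauchy_schwarz[of "V s" "- K (V s)"] by simp
        also have "\<dots> \<le> norm (V s) * (norm (V s) * M)" by (intro mult_left_mono M) auto
        also have "\<dots> = M * inner (V s) (V s)" by (simp add: norm_eq_sqrt_inner)
        finally have "- inner (V s) (K (V s)) \<le> M * inner (V s) (V s)" .
        moreover have "0 \<le> inner (V s) (diag \<mu> (V s))" using s by (intro inner_diag_nonneg \<mu> V) auto
        ultimately show ?thesis using s by (simp add: V(2) inner_diff_right)
      qed
      then have "exp (- 2 * M * s) * (2 * inner (V s) (d s) - 2 * M * inner (V s) (V s)) \<le> 0"
        by (intro mult_nonneg_nonpos) auto
      ultimately show "\<exists>y. (q has_real_derivative y) (at s) \<and> y \<le> 0" by blast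
    next
      show "continuous_on {0..t} q" unfolding q_def by (intro continuous_intros cV)
    qed (use t in auto)
  qed simp
  then have "inner (V t) (V t) \<le> 0" by (simp only: q_def V0 inner_zero_left mult_zero_right) (simp add: mult_le_0_iff)
  then have "V t = 0" using inner_gt_zero_iff[of "V t"] by linarith
  moreover have "diag \<mu> 0 = 0" by (simp add: diag_def flip: zero_ell2_def)
  ultimately have "d t = 0"
    unfolding V(2)[OF t] by (simp only: linear_0[OF bounded_linear.linear[OF K]] add_0_left minus_zero)
  then show ?thesis by (simp add: d_def)
qed


section \<open>Square-integrable disturbances and their moving averages\<close>

lemma L2H_D:
  assumes "w \<in> L2H"
  shows L2H_measurable: "(\<lambda>s. indicator {0..} s *\<^sub>R w s) \<in> borel_measurable lborel"
    and L2H_square_integrable: "set_integrable lborel {0..} (\<lambda>s. (norm (w s))\<^sup>2)"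
    and L2H_locally_integrable: "locally_integrable w"
proof -
  show m[measurable]: "(\<lambda>s. indicator {0..} s *\<^sub>R w s) \<in> borel_measurable lborel"
    using assms by (simp add: L2H_def set_borel_measurable_def)
  have eq: "indicator {0..} s *\<^sub>R (norm (w s))\<^sup>2 = (norm (indicator {0..} s *\<^sub>R w s))\<^sup>2" for s :: real
    by (simp split: split_indicator)
  show sq: "set_integrable lborel {0..} (\<lambda>s. (norm (w s))\<^sup>2)"
    unfolding set_integrable_def
  proof (rule integrableI_bounded)
    show "(\<lambda>s. indicator {0..} s *\<^sub>R (norm (w s))\<^sup>2) \<in> borel_measurable lborel"
      unfolding eq by measurable
    have "(\<integral>\<^sup>+ s. ennreal (norm (indicator {0..} s *\<^sub>R (norm (w s))\<^sup>2)) \<partial>lborel) = sq_int w"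
      unfolding sq_int_def by (intro nn_integral_cong) (simp split: split_indicator)
    then show "(\<integral>\<^sup>+ s. ennreal (norm (indicator {0..} s *\<^sub>R (norm (w s))\<^sup>2)) \<partial>lborel) < \<infinity>"
      using assms by (simp add: L2H_def)
  qed
  show "locally_integrable w"
    unfolding locally_integrable_def
  proof
    fix T :: real
    have "set_integrable lborel {0..T} (\<lambda>s. (norm (w s))\<^sup>2)"
      by (rule set_integrable_subset[OF sq]) auto
    then have i: "set_integrable lborel {0..T} (\<lambda>s. 1 + (norm (w s))\<^sup>2)"
      by (rule set_integral_add(1)[OF borel_integrable_atLeastAtMost'[OF continuous_on_const]])
    have "(\<lambda>s. indicator {0..T} s *\<^sub>R (indicator {0..} s *\<^sub>R w s)) \<in> borel_measurable lborel"
      by measurable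
    also have "(\<lambda>s. indicator {0..T} s *\<^sub>R (indicator {0..} s *\<^sub>R w s)) = (\<lambda>s. indicator {0..T} s *\<^sub>R w s)"
      by (auto simp: fun_eq_iff split: split_indicator)
    finally have "set_borel_measurable lborel {0..T} w" by (simp add: set_borel_measurable_def)
    moreover have "norm (w s) \<le> norm (1 + (norm (w s))\<^sup>2)" for s
    proof -
      have "2 * norm (w s) \<le> 1 + (norm (w s))\<^sup>2" using sum_squares_bound[of 1 "norm (w s)"] by simp
      then show ?thesis using norm_ge_zero[of "w s"] unfolding real_norm_def by linarith
    qed
    ultimately show "set_integrable lborel {0..T} w"
      by (intro set_integrable_bound[OF i]) auto
  qed
qed

text \<open>
  Supplies the linear growth that the weight in the contraction argument absorbs, by
  \<open>2x \<le> x\<^sup>2 + 1\<close>.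
\<close>

lemma L2H_growth:
  assumes w: "w \<in> L2H" and T: "bounded_linear (T :: ell2 \<Rightarrow> ell2)"
  obtains N where "0 \<le> N" "\<And>t. 0 \<le> t \<Longrightarrow> (LINT s:{0..t}|lborel. norm (T (w s))) \<le> N + t"
proof -
  obtain M where M: "\<And>x. norm (T x) \<le> norm x * M" "0 < M" using bounded_linear.pos_bounded[OF T] by auto
  define N where "N = M\<^sup>2 * (LINT s:{0..}|lborel. (norm (w s))\<^sup>2)"
  have "0 \<le> N"
    unfolding N_def set_lebesgue_integral_def by (intro mult_nonneg_nonneg Bochner_Integration.integral_nonneg) auto
  moreover have "(LINT s:{0..t}|lborel. norm (T (w s))) \<le> N + t" if t: "0 \<le> t" for t
  proof -
    have sub: "set_integrable lborel {0..t} (\<lambda>s. (norm (w s))\<^sup>2)"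
      by (rule set_integrable_subset[OF L2H_square_integrable[OF w]]) auto
    have "(LINT s:{0..t}|lborel. norm (T (w s))) \<le> (LINT s:{0..t}|lborel. M\<^sup>2 * (norm (w s))\<^sup>2 + 1)"
    proof (rule set_integral_mono)
      show "set_integrable lborel {0..t} (\<lambda>s. norm (T (w s)))"
        using locally_integrable_bounded_linear[OF T L2H_locally_integrable[OF w]]
        by (intro set_integrable_norm) (simp add: locally_integrable_def)
      show "set_integrable lborel {0..t} (\<lambda>s. M\<^sup>2 * (norm (w s))\<^sup>2 + 1)"
        by (rule set_integral_add(1)[OF set_integrable_mult_right[OF sub] borel_integrable_atLeastAtMost'[OF continuous_on_const]])
      show "norm (T (w s)) \<le> M\<^sup>2 * (norm (w s))\<^sup>2 + 1" for s
      proof -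
        have "2 * norm (T (w s)) \<le> (norm (T (w s)))\<^sup>2 + 1"
          using sum_squares_bound[of "norm (T (w s))" 1] by simp
        also have "(norm (T (w s)))\<^sup>2 \<le> (norm (w s) * M)\<^sup>2" by (intro power_mono M) auto
        finally have "2 * norm (T (w s)) \<le> M\<^sup>2 * (norm (w s))\<^sup>2 + 1"
          by (simp add: power_mult_distrib mult.commute)
        then show ?thesis using norm_ge_zero[of "T (w s)"] by linarith
      qed
    qed
    also have "\<dots> = M\<^sup>2 * (LINT s:{0..t}|lborel. (norm (w s))\<^sup>2) + (LINT s:{0..t}|lborel. 1)"
      by (simp only: set_integral_add(2)[OF set_integrable_mult_right[OF sub]
        borel_integrable_atLeastAtMost'[OF continuous_on_const]] set_integral_mult_right)
    also have "(LINT s:{0..t}|lborel. 1) = t"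
      using t by (simp add: set_lebesgue_integral_def)
    also have "M\<^sup>2 * (LINT s:{0..t}|lborel. (norm (w s))\<^sup>2) \<le> N"
      unfolding N_def set_lebesgue_integral_def
    proof (intro mult_left_mono integral_mono)
      show "integrable lborel (\<lambda>s. indicat_real {0..t} s *\<^sub>R (norm (w s))\<^sup>2)"
        "integrable lborel (\<lambda>s. indicat_real {0..} s *\<^sub>R (norm (w s))\<^sup>2)"
        using sub L2H_square_integrable[OF w] by (auto simp: set_integrable_def)
    qed (auto split: split_indicator)
    finally show "(LINT s:{0..t}|lborel. norm (T (w s))) \<le> N + t" by simp
  qed
  ultimately show ?thesis by (rule that)
qed

definition steklov :: "real \<Rightarrow> (real \<Rightarrow> ell2) \<Rightarrow> real \<Rightarrow> ell2" where
  "steklov h f t = (1 / h) *\<^sub>R (LINT s:{t..t + h}|lborel. f s)"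

lemma steklov_eq_difference_quotient:
  assumes "locally_integrable f" "0 < h" "0 \<le> t"
  shows "steklov h f t = (1 / h) *\<^sub>R ((LINT s:{0..t + h}|lborel. f s) - (LINT s:{0..t}|lborel. f s))"
  using set_integral_interval_split[OF assms(1,3), of "t + h"] assms by (simp add: steklov_def)

lemma continuous_on_primitive:
  fixes f :: "real \<Rightarrow> ell2"
  assumes f: "locally_integrable f"
  shows "continuous_on {0..} (\<lambda>t. LINT s:{0..t}|lborel. f s)"
proof (rule continuous_on_parametric_integral[OF f])
  show "set_borel_measurable lborel {0..t} f" for t
    using f unfolding locally_integrable_def set_integrable_def set_borel_measurable_def
    by (blast intro: borel_measurable_integrable)
qed auto

lemma continuous_on_steklov:
  assumes f: "locally_integrable f" and h: "0 < h"
  shows "continuous_on {0..} (steklov h f)"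
proof (rule continuous_on_eq)
  show "continuous_on {0..} (\<lambda>t. (1 / h) *\<^sub>R ((LINT s:{0..t + h}|lborel. f s) - (LINT s:{0..t}|lborel. f s)))"
    using h by (intro continuous_intros continuous_on_primitive[OF f] continuous_on_compose2[OF continuous_on_primitive[OF f], of _ "\<lambda>t. t + h"]) auto
qed (simp add: steklov_eq_difference_quotient[OF f h])

lemma steklov_bounded_linear:
  assumes T: "bounded_linear T" and f: "locally_integrable f" and "0 \<le> t"
  shows "steklov h (\<lambda>s. T (f s)) t = T (steklov h f t)"
  unfolding steklov_def
  by (simp add: set_integral_bounded_linear(2)[OF T locally_integrableD[OF f \<open>0 \<le> t\<close>]]
    linear_scale[OF bounded_linear.linear[OF T]])

text \<open>
  Jensen's inequality for the average \<open>c\<close> of \<open>w\<close>: integrate \<open>0 \<le> |w - c|\<^sup>2\<close>.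
\<close>

lemma norm_steklov_sq_le:
  assumes w: "w \<in> L2H" and h: "0 < h" and t: "0 \<le> t"
  shows "ennreal ((norm (steklov h w t))\<^sup>2)
    \<le> ennreal (1 / h) * (\<integral>\<^sup>+ s\<in>{t..t + h}. ennreal ((norm (w s))\<^sup>2) \<partial>lborel)"
proof -
  define c where "c = steklov h w t"
  note wi = locally_integrableD[OF L2H_locally_integrable[OF w] t, of "t + h"]
  have sq: "set_integrable lborel {t..t + h} (\<lambda>s. (norm (w s))\<^sup>2)"
    by (rule set_integrable_subset[OF L2H_square_integrable[OF w]]) (use t in auto)
  note ci = set_integral_bounded_linear[OF bounded_linear_inner_right[of c] wi]
  have k: "set_integrable lborel {t..t + h} (\<lambda>s. (norm c)\<^sup>2)"
    by (intro borel_integrable_atLeastAtMost' continuous_intros)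
  have "h * (norm c)\<^sup>2 = 2 * inner c (LINT s:{t..t + h}|lborel. w s) - (LINT s:{t..t + h}|lborel. (norm c)\<^sup>2)"
  proof -
    have "(LINT s:{t..t + h}|lborel. w s) = h *\<^sub>R c" using h by (simp add: c_def steklov_def)
    moreover have "(LINT s:{t..t + h}|lborel. (norm c)\<^sup>2) = h * (norm c)\<^sup>2"
      using h by (simp add: set_lebesgue_integral_def)
    ultimately show ?thesis by (simp add: power2_norm_eq_inner)
  qed
  also have "\<dots> = (LINT s:{t..t + h}|lborel. 2 * inner c (w s) - (norm c)\<^sup>2)"
    using set_integral_diff(2)[OF set_integrable_mult_right[OF ci(1), of 2] k] ci(2) by simp
  also have "\<dots> \<le> (LINT s:{t..t + h}|lborel. (norm (w s))\<^sup>2)"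
  proof (rule set_integral_mono)
    show "2 * inner c (w s) - (norm c)\<^sup>2 \<le> (norm (w s))\<^sup>2" for s
    proof -
      have "0 \<le> (norm (w s - c))\<^sup>2" by simp
      then show ?thesis
        by (simp add: power2_norm_eq_inner inner_diff_left inner_diff_right inner_commute)
    qed
  qed (use sq set_integral_diff(1)[OF set_integrable_mult_right[OF ci(1), of 2] k] in auto)
  finally have "(norm c)\<^sup>2 \<le> 1 / h * (LINT s:{t..t + h}|lborel. (norm (w s))\<^sup>2)"
    using h by (simp add: field_simps)
  then have "ennreal ((norm c)\<^sup>2) \<le> ennreal (1 / h) * ennreal (LINT s:{t..t + h}|lborel. (norm (w s))\<^sup>2)"
    using h by (subst ennreal_mult[symmetric]) (auto simp: ennreal_leI set_lebesgue_integral_def intro!: Bochner_Integration.integral_nonneg)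
  also have "ennreal (LINT s:{t..t + h}|lborel. (norm (w s))\<^sup>2) = (\<integral>\<^sup>+ s\<in>{t..t + h}. ennreal ((norm (w s))\<^sup>2) \<partial>lborel)"
    using sq unfolding set_lebesgue_integral_def set_integrable_def
    by (subst nn_integral_eq_integral[symmetric]) (auto intro!: nn_integral_cong split: split_indicator)
  finally show ?thesis by (simp add: c_def)
qed

text \<open>
  By Tonelli's theorem: a time \<open>s\<close> contributes only to the averages over the windows starting in
  \<open>[s - h, s]\<close>, an interval whose length \<open>h\<close> cancels the factor \<open>1/h\<close>.
\<close>

lemma steklov_sq_int_le:
  assumes w: "w \<in> L2H" and h: "0 < h"
  shows "(\<integral>\<^sup>+ t\<in>{0..T}. ennreal ((norm (steklov h w t))\<^sup>2) \<partial>lborel) \<le> sq_int w"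
proof -
  define f where "f s = ennreal ((norm (indicator {0..} s *\<^sub>R w s))\<^sup>2)" for s :: real
  have f[measurable]: "f \<in> borel_measurable lborel"
    unfolding f_def using L2H_measurable[OF w] by measurable
  define \<kappa> where "\<kappa> t s = (if 0 \<le> t \<and> t \<le> s \<and> s \<le> t + h then 1 else 0 :: ennreal)" for t s
  have "(\<integral>\<^sup>+ t\<in>{0..T}. ennreal ((norm (steklov h w t))\<^sup>2) \<partial>lborel)
      \<le> (\<integral>\<^sup>+ t. ennreal (1 / h) * (\<integral>\<^sup>+ s. \<kappa> t s * f s \<partial>lborel) \<partial>lborel)"
  proof (rule nn_integral_mono)
    fix t :: real
    show "ennreal ((norm (steklov h w t))\<^sup>2) * indicator {0..T} t \<le> ennreal (1 / h) * (\<integral>\<^sup>+ s. \<kappa> t s * f s \<partial>lborel)"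
    proof (cases "0 \<le> t")
      case True
      have "(\<integral>\<^sup>+ s\<in>{t..t + h}. ennreal ((norm (w s))\<^sup>2) \<partial>lborel) = (\<integral>\<^sup>+ s. \<kappa> t s * f s \<partial>lborel)"
        using True by (intro nn_integral_cong) (auto simp: \<kappa>_def f_def split: split_indicator)
      then show ?thesis
        using norm_steklov_sq_le[OF w h True] by (auto split: split_indicator)
    qed auto
  qed
  also have "\<dots> = ennreal (1 / h) * (\<integral>\<^sup>+ t. (\<integral>\<^sup>+ s. \<kappa> t s * f s \<partial>lborel) \<partial>lborel)"
    unfolding \<kappa>_def by (intro nn_integral_cmult) measurable
  also have "(\<integral>\<^sup>+ t. (\<integral>\<^sup>+ s. \<kappa> t s * f s \<partial>lborel) \<partial>lborel) = (\<integral>\<^sup>+ s. (\<integral>\<^sup>+ t. \<kappa> t s * f s \<partial>lborel) \<partial>lborel)"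
    unfolding \<kappa>_def by (rule lborel_pair.Fubini'[symmetric]) measurable
  also have "\<dots> \<le> (\<integral>\<^sup>+ s. ennreal h * f s \<partial>lborel)"
  proof (rule nn_integral_mono)
    fix s :: real
    have "(\<integral>\<^sup>+ t. \<kappa> t s * f s \<partial>lborel) \<le> (\<integral>\<^sup>+ t. f s * indicator {s - h..s} t \<partial>lborel)"
      by (intro nn_integral_mono) (auto simp: \<kappa>_def split: split_indicator)
    also have "\<dots> = ennreal h * f s"
      using h by (subst nn_integral_cmult_indicator) (auto simp: mult.commute)
    finally show "(\<integral>\<^sup>+ t. \<kappa> t s * f s \<partial>lborel) \<le> ennreal h * f s" .
  qed
  also have "\<dots> = ennreal h * (\<integral>\<^sup>+ s. f s \<partial>lborel)"
    by (rule nn_integral_cmult[OF f])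
  also have "(\<integral>\<^sup>+ s. f s \<partial>lborel) = sq_int w"
    unfolding sq_int_def f_def by (intro nn_integral_cong) (auto split: split_indicator)
  also have "ennreal (1 / h) * (ennreal h * sq_int w) = sq_int w"
    using h by (simp add: mult.assoc[symmetric] ennreal_mult[symmetric])
  finally show ?thesis by (simp add: mult_left_mono)
qed

lemma steklov_tendsto:
  assumes f: "continuous_on {0..} f" and t: "0 \<le> t"
    and h: "h \<longlonglongrightarrow> 0" "\<And>n. 0 < h n" "\<And>n. h n \<le> 1"
  shows "(\<lambda>n. steklov (h n) f t) \<longlonglongrightarrow> f t"
proof -
  let ?V = "\<lambda>t. LINT s:{0..t}|lborel. f s"
  have "(?V has_vector_derivative f t) (at t within {0..t + 1})"
    by (rule primitive_has_derivative[OF f t]) simp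
  then have "((\<lambda>y. (1 / norm (y - t)) *\<^sub>R (?V y - (?V t + (y - t) *\<^sub>R f t))) \<longlongrightarrow> 0) (at t within {0..t + 1})"
    by (simp add: has_vector_derivative_def has_derivative_within)
  moreover have "filterlim (\<lambda>n. t + h n) (at t within {0..t + 1}) sequentially"
    unfolding filterlim_at using h t tendsto_add[OF tendsto_const h(1), of t]
    by (auto intro!: always_eventually simp: less_imp_le less_imp_neq[symmetric] add_nonneg_nonneg)
  ultimately have "(\<lambda>n. (1 / norm (t + h n - t)) *\<^sub>R (?V (t + h n) - (?V t + (t + h n - t) *\<^sub>R f t))) \<longlonglongrightarrow> 0"
    by (rule filterlim_compose)
  moreover have "(1 / norm (t + h n - t)) *\<^sub>R (?V (t + h n) - (?V t + (t + h n - t) *\<^sub>R f t)) = steklov (h n) f t - f t" for n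
    using h(2)[of n]
    by (simp add: steklov_eq_difference_quotient[OF locally_integrable_continuous[OF f] _ t] algebra_simps)
  ultimately have "(\<lambda>n. steklov (h n) f t - f t) \<longlonglongrightarrow> 0" by simp
  then show ?thesis by (rule LIM_zero_cancel)
qed


section \<open>The energy estimate\<close>

lemma continuous_nn_integral_eq:
  fixes f :: "real \<Rightarrow> real"
  assumes f: "continuous_on {a..b} f" and "\<And>t. 0 \<le> f t"
  shows "(\<integral>\<^sup>+ t\<in>{a..b}. ennreal (f t) \<partial>lborel) = ennreal (integral {a..b} f)"
proof -
  have i: "set_integrable lborel {a..b} f" by (rule borel_integrable_atLeastAtMost'[OF f])
  have "(\<integral>\<^sup>+ t\<in>{a..b}. ennreal (f t) \<partial>lborel) = ennreal (LINT t:{a..b}|lborel. f t)"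
    using i assms(2) unfolding set_lebesgue_integral_def set_integrable_def
    by (subst nn_integral_eq_integral[symmetric]) (auto intro!: nn_integral_cong split: split_indicator)
  then show ?thesis by (simp add: set_borel_integral_eq_integral(2)[OF i])
qed

text \<open>
  The abstract setting of the estimate is a linear operator \<open>L\<close> for which the quadratic form of \<open>R\<close> is a
  storage function: \<open>dissipation\<close> says that along \<open>x' = - L x\<close> it decreases at the rate
  \<open>|x|\<^sup>2 + |C x|\<^sup>2 + |B\<^sub>2\<^sup>*R x|\<^sup>2 / \<gamma>\<close>. The last term pays for the disturbance.
\<close>

context
  fixes D :: "ell2 set" and L R C B2 :: "ell2 \<Rightarrow> ell2" and \<gamma> :: real
  assumes D_diff: "\<And>x y. x \<in> D \<Longrightarrow> y \<in> D \<Longrightarrow> x - y \<in> D \<and> L (x - y) = L x - L y"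
    and D_scaleR: "\<And>r x. x \<in> D \<Longrightarrow> r *\<^sub>R x \<in> D \<and> L (r *\<^sub>R x) = r *\<^sub>R L x"
    and R: "bounded_linear R" and R_sym: "\<And>x y. inner (R x) y = inner x (R y)"
    and R_nonneg: "\<And>x. 0 \<le> inner (R x) x"
    and C: "bounded_linear C" and B2: "bounded_linear B2" and \<gamma>: "0 < \<gamma>"
    and dissipation: "\<And>x. x \<in> D \<Longrightarrow>
      2 * inner (L x) (R x) = (norm x)\<^sup>2 + (norm (C x))\<^sup>2 + (1 / \<gamma>) * (norm (adjoint B2 (R x)))\<^sup>2"
begin

text \<open>
  The averaged solution is continuously differentiable with values in \<open>D\<close>, so its energy \<open>E\<close> can
  be differentiated.
\<close>

lemma steklov_energy_estimate:
  assumes u: "solves D L (\<lambda>t. B2 (w t)) u0 u" and w: "w \<in> L2H" and h: "0 < h" and T: "0 \<le> T"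
  shows "(\<integral>\<^sup>+ t\<in>{0..T}. ennreal ((norm (steklov h u t))\<^sup>2 + (norm (C (steklov h u t)))\<^sup>2) \<partial>lborel)
    \<le> ennreal (inner (steklov h u 0) (R (steklov h u 0))) + ennreal \<gamma> * sq_int w"
proof -
  define U where "U = steklov h u"
  define W where "W = steklov h w"
  define E where "E t = inner (U t) (R (U t))" for t
  define F where "F t = (norm (U t))\<^sup>2 + (norm (C (U t)))\<^sup>2" for t
  have uc: "continuous_on {0..} u" using u by (simp add: solves_def)
  note ui = locally_integrable_continuous[OF uc] and wi = L2H_locally_integrable[OF w]
  have Uc: "continuous_on {0..T} U" and Wc: "continuous_on {0..T} W"
    unfolding U_def W_def
    by (rule continuous_on_subset[OF continuous_on_steklov[OF ui h]], simp)
      (rule continuous_on_subset[OF continuous_on_steklov[OF wi h]], simp)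
  have Fc: "continuous_on {0..T} F"
    unfolding F_def by (intro continuous_intros Uc continuous_on_compose2[OF linear_continuous_on[OF C] Uc]) auto
  have gc: "continuous_on {0..T} (\<lambda>t. (norm (W t))\<^sup>2)" by (intro continuous_intros Wc)
  have Ec: "continuous_on {0..T} E"
    unfolding E_def by (intro continuous_intros Uc continuous_on_compose2[OF linear_continuous_on[OF R] Uc]) auto
  (* The increments of the solution over [t, t + h] obey the equation with averaged data. *)
  have U_eq: "U t \<in> D" "(1 / h) *\<^sub>R (u (t + h) - u t) = B2 (W t) - L (U t)" if t: "0 \<le> t" for t
  proof -
    let ?V = "\<lambda>t. LINT s:{0..t}|lborel. u s" and ?G = "\<lambda>t. LINT s:{0..t}|lborel. B2 (w s)"
    have Ut: "U t = (1 / h) *\<^sub>R (?V (t + h) - ?V t)"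
      unfolding U_def by (rule steklov_eq_difference_quotient[OF ui h t])
    have V: "?V t \<in> D" "?V (t + h) \<in> D"
      and eq: "u t + L (?V t) = u0 + ?G t" "u (t + h) + L (?V (t + h)) = u0 + ?G (t + h)"
      using u t h by (auto simp: solves_def)
    have BW: "B2 (W t) = (1 / h) *\<^sub>R (?G (t + h) - ?G t)"
      unfolding W_def steklov_bounded_linear[OF B2 wi t, symmetric]
      by (rule steklov_eq_difference_quotient[OF locally_integrable_bounded_linear[OF B2 wi] h t])
    show "U t \<in> D" unfolding Ut using D_diff[OF V(2,1)] D_scaleR by blast
    have "L (U t) = (1 / h) *\<^sub>R (L (?V (t + h)) - L (?V t))"
      unfolding Ut using D_diff[OF V(2,1)] D_scaleR by metis
    moreover have "u (t + h) - u t = (?G (t + h) - ?G t) - (L (?V (t + h)) - L (?V t))"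
      using eq unfolding eq_diff_eq[symmetric] by simp
    ultimately show "(1 / h) *\<^sub>R (u (t + h) - u t) = B2 (W t) - L (U t)"
      unfolding BW by (simp add: scaleR_diff_right)
  qed
  have U_deriv: "(U has_vector_derivative (1 / h) *\<^sub>R (u (t + h) - u t)) (at t)" if t: "0 < t" for t
  proof -
    let ?V = "\<lambda>t. LINT s:{0..t}|lborel. u s"
    have d: "(?V has_vector_derivative u s) (at s)" if "0 < s" for s
      using primitive_has_derivative[OF uc, of s "s + 1"] that by (simp add: at_within_Icc_at)
    have "((\<lambda>t. t + h) has_vector_derivative 1) (at t)" by (auto intro!: derivative_eq_intros)
    from vector_diff_chain_at[OF this d] t h
    have "((\<lambda>t. ?V (t + h)) has_vector_derivative u (t + h)) (at t)" by (simp add: o_def)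
    then have "((\<lambda>t. (1 / h) *\<^sub>R (?V (t + h) - ?V t)) has_vector_derivative (1 / h) *\<^sub>R (u (t + h) - u t)) (at t)"
      using d[OF t] by (auto intro!: derivative_eq_intros)
    then show ?thesis
      by (rule has_vector_derivative_transform_within_open[of _ _ _ "{0<..}"])
        (use t in \<open>auto simp: U_def steklov_eq_difference_quotient[OF ui h]\<close>)
  qed
  let ?e = "\<lambda>t. 2 * inner ((1 / h) *\<^sub>R (u (t + h) - u t)) (R (U t))"
  have E_deriv: "(E has_vector_derivative ?e t) (at t)" if t: "0 < t" for t
  proof -
    let ?d = "(1 / h) *\<^sub>R (u (t + h) - u t)"
    have "((\<lambda>t. R (U t)) has_vector_derivative R ?d) (at t)"
      by (rule bounded_linear.has_vector_derivative[OF R U_deriv[OF t]])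
    then have "(E has_vector_derivative inner (U t) (R ?d) + inner ?d (R (U t))) (at t)"
      unfolding E_def using U_deriv[OF t]
      by (rule bounded_bilinear.has_vector_derivative[OF bounded_bilinear_inner, rotated])
    moreover have "inner (U t) (R ?d) = inner ?d (R (U t))"
      by (metis R_sym inner_commute)
    ultimately show ?thesis by simp
  qed
  (* Completing the square in W absorbs the disturbance term. *)
  have e_le: "?e t \<le> \<gamma> * (norm (W t))\<^sup>2 - F t" if t: "0 \<le> t" for t
  proof -
    let ?p = "adjoint B2 (R (U t))"
    have "?e t = 2 * inner (W t) ?p - 2 * inner (L (U t)) (R (U t))"
      unfolding U_eq(2)[OF t] by (simp add: inner_diff_left inner_adjoint[OF B2])
    also have "\<dots> = 2 * inner (W t) ?p - F t - (1 / \<gamma>) * (norm ?p)\<^sup>2"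
      using dissipation[OF U_eq(1)[OF t]] by (simp add: F_def)
    also have "2 * inner (W t) ?p \<le> \<gamma> * (norm (W t))\<^sup>2 + (1 / \<gamma>) * (norm ?p)\<^sup>2"
    proof -
      have "0 \<le> (1 / \<gamma>) * (norm (\<gamma> *\<^sub>R W t - ?p))\<^sup>2" using \<gamma> by simp
      also have "\<dots> = \<gamma> * (norm (W t))\<^sup>2 + (1 / \<gamma>) * (norm ?p)\<^sup>2 - 2 * inner (W t) ?p"
        using \<gamma> by (simp add: power2_norm_eq_inner inner_diff_left inner_diff_right inner_commute field_simps)
      finally show ?thesis by simp
    qed
    finally show ?thesis by simp
  qed
  have "(?e has_integral E T - E 0) {0..T}"
    by (rule fundamental_theorem_of_calculus_interior[OF T Ec]) (use E_deriv in auto)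
  moreover have "((\<lambda>t. \<gamma> * (norm (W t))\<^sup>2 - F t) has_integral
      \<gamma> * integral {0..T} (\<lambda>t. (norm (W t))\<^sup>2) - integral {0..T} F) {0..T}"
    by (intro has_integral_diff has_integral_mult_right integrable_integral integrable_continuous_interval Fc gc)
  ultimately have "E T - E 0 \<le> \<gamma> * integral {0..T} (\<lambda>t. (norm (W t))\<^sup>2) - integral {0..T} F"
    by (rule has_integral_le) (use e_le in auto)
  moreover have E_nonneg: "0 \<le> E t" for t using R_nonneg[of "U t"] by (simp add: E_def inner_commute)
  ultimately have "integral {0..T} F \<le> E 0 + \<gamma> * integral {0..T} (\<lambda>t. (norm (W t))\<^sup>2)"
    using E_nonneg[of T] by linarith
  then have "ennreal (integral {0..T} F) \<le> ennreal (E 0 + \<gamma> * integral {0..T} (\<lambda>t. (norm (W t))\<^sup>2))"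
    by (rule ennreal_leI)
  also have "\<dots> = ennreal (E 0) + ennreal \<gamma> * ennreal (integral {0..T} (\<lambda>t. (norm (W t))\<^sup>2))"
    using E_nonneg \<gamma> gc by (simp add: ennreal_plus ennreal_mult integral_nonneg integrable_continuous_interval)
  also have "ennreal (integral {0..T} (\<lambda>t. (norm (W t))\<^sup>2)) = (\<integral>\<^sup>+ t\<in>{0..T}. ennreal ((norm (W t))\<^sup>2) \<partial>lborel)"
    by (rule continuous_nn_integral_eq[OF gc, symmetric]) simp
  also have "\<dots> \<le> sq_int w" unfolding W_def by (rule steklov_sq_int_le[OF w h])
  also have "ennreal (integral {0..T} F) = (\<integral>\<^sup>+ t\<in>{0..T}. ennreal (F t) \<partial>lborel)"
    by (rule continuous_nn_integral_eq[OF Fc, symmetric]) (simp add: F_def)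
  finally show ?thesis
    by (simp add: F_def E_def U_def mult_left_mono add_left_mono)
qed

text \<open>
  Averaging length and time horizon pass to the limit together, so that a single application of
  Fatou's lemma gives the estimate on the half line.
\<close>

lemma energy_estimate:
  assumes u: "solves D L (\<lambda>t. B2 (w t)) u0 u" and w: "w \<in> L2H"
  shows "sq_int u + sq_int (\<lambda>t. C (u t)) \<le> ennreal (inner u0 (R u0)) + ennreal \<gamma> * sq_int w"
proof -
  have uc: "continuous_on {0..} u" using u by (simp add: solves_def)
  have u_0: "u 0 = u0"
  proof -
    have z: "(LINT s:{0}|lborel. f s) = (0::ell2)" for f :: "real \<Rightarrow> ell2"
    proof -
      have "(\<lambda>s. indicator {0} s *\<^sub>R f s) = (\<lambda>s. indicator {0} s *\<^sub>R f 0)"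
        by (auto simp: fun_eq_iff split: split_indicator)
      then show ?thesis unfolding set_lebesgue_integral_def by simp
    qed
    have "0 \<in> D" "u 0 + L 0 = u0" using u unfolding solves_def by (auto simp: z dest!: spec[of _ 0])
    then show ?thesis using D_scaleR[of 0 0] by simp
  qed
  define h where "h n = 1 / real (Suc n)" for n
  have h: "h \<longlonglongrightarrow> 0" "0 < h n" "h n \<le> 1" for n
    unfolding h_def using LIMSEQ_inverse_real_of_nat by (auto simp: inverse_eq_divide)
  define \<Phi> where "\<Phi> x = ennreal ((norm x)\<^sup>2 + (norm (C x))\<^sup>2)" for x
  have Cu: "continuous_on {0..} (\<lambda>t. C (u t))"
    by (rule continuous_on_compose2[OF linear_continuous_on[OF C] uc]) auto
  have \<Phi>_cont: "continuous_on UNIV \<Phi>"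
    unfolding \<Phi>_def by (intro continuous_on_ennreal continuous_intros linear_continuous_on C)
  define G where "G n t = \<Phi> (steklov (h n) u t) * indicator {0..real n} t" for n t
  have G_meas: "G n \<in> borel_measurable lborel" for n
  proof -
    have "continuous_on {0..real n} (steklov (h n) u)"
      by (rule continuous_on_subset[OF continuous_on_steklov[OF locally_integrable_continuous[OF uc] h(2)]]) auto
    then have "(\<lambda>t. indicator {0..real n} t *\<^sub>R steklov (h n) u t) \<in> borel_measurable lborel"
      by (simp add: borel_measurable_continuous_on_indicator)
    then have "(\<lambda>t. \<Phi> (indicator {0..real n} t *\<^sub>R steklov (h n) u t)) \<in> borel_measurable lborel"
      by (rule measurable_compose[OF _ borel_measurable_continuous_onI[OF \<Phi>_cont]])
    moreover have "\<Phi> (indicator {0..real n} t *\<^sub>R steklov (h n) u t) = G n t" for t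
      using linear_0[OF bounded_linear.linear[OF C]] by (simp add: G_def \<Phi>_def split: split_indicator)
    ultimately show ?thesis by simp
  qed
  have G_lim: "(\<lambda>n. G n t) \<longlonglongrightarrow> \<Phi> (u t) * indicator {0..} t" for t
  proof (cases "0 \<le> t")
    case True
    have "(\<lambda>n. \<Phi> (steklov (h n) u t)) \<longlonglongrightarrow> \<Phi> (u t)"
      using \<Phi>_cont steklov_tendsto[OF uc True h] by (auto simp: continuous_on_sequentially o_def)
    moreover have "\<forall>\<^sub>F n in sequentially. \<Phi> (steklov (h n) u t) = G n t"
      using eventually_ge_at_top[of "nat \<lceil>t\<rceil>"]
      by eventually_elim (use True in \<open>auto simp: G_def nat_le_iff ceiling_le_iff\<close>)
    ultimately show ?thesis using True by (auto elim: Lim_transform_eventually)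
  qed (simp add: G_def)
  have "sq_int u + sq_int (\<lambda>t. C (u t)) = (\<integral>\<^sup>+ t. \<Phi> (u t) * indicator {0..} t \<partial>lborel)"
  proof -
    have m: "(\<lambda>t. ennreal ((norm (f t))\<^sup>2) * indicator {0..} t) \<in> borel_measurable lborel"
      if "continuous_on {0..} f" for f :: "real \<Rightarrow> ell2"
    proof -
      have "(\<lambda>t. indicator {0..} t *\<^sub>R f t) \<in> borel_measurable lborel"
        using that by (simp add: borel_measurable_continuous_on_indicator)
      then have "(\<lambda>t. ennreal ((norm (indicator {0..} t *\<^sub>R f t))\<^sup>2)) \<in> borel_measurable lborel"
        by measurable
      also have "(\<lambda>t. ennreal ((norm (indicator {0..} t *\<^sub>R f t))\<^sup>2)) = (\<lambda>t. ennreal ((norm (f t))\<^sup>2) * indicator {0..} t)"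
        by (auto simp: fun_eq_iff split: split_indicator)
      finally show ?thesis .
    qed
    show ?thesis
      using m[OF uc] m[OF Cu] unfolding sq_int_def \<Phi>_def
      by (subst nn_integral_add[symmetric]) (auto intro!: nn_integral_cong simp: ennreal_plus distrib_right)
  qed
  also have "\<dots> = (\<integral>\<^sup>+ t. liminf (\<lambda>n. G n t) \<partial>lborel)"
    by (intro nn_integral_cong) (metis G_lim lim_imp_Liminf trivial_limit_sequentially)
  also have "\<dots> \<le> liminf (\<lambda>n. integral\<^sup>N lborel (G n))"
    by (rule nn_integral_liminf[OF G_meas])
  also have "\<dots> \<le> liminf (\<lambda>n. ennreal (inner (steklov (h n) u 0) (R (steklov (h n) u 0))) + ennreal \<gamma> * sq_int w)"
  proof (rule Liminf_mono, rule always_eventually, rule allI)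
    fix n
    show "integral\<^sup>N lborel (G n) \<le> ennreal (inner (steklov (h n) u 0) (R (steklov (h n) u 0))) + ennreal \<gamma> * sq_int w"
      using steklov_energy_estimate[OF u w h(2), of "real n" n] unfolding G_def \<Phi>_def by simp
  qed
  also have "\<dots> = ennreal (inner u0 (R u0)) + ennreal \<gamma> * sq_int w"
  proof (rule lim_imp_Liminf)
    have "(\<lambda>n. steklov (h n) u 0) \<longlonglongrightarrow> u0"
      using steklov_tendsto[OF uc order_refl h] by (simp add: u_0)
    then show "(\<lambda>n. ennreal (inner (steklov (h n) u 0) (R (steklov (h n) u 0))) + ennreal \<gamma> * sq_int w)
        \<longlonglongrightarrow> ennreal (inner u0 (R u0)) + ennreal \<gamma> * sq_int w"
      by (intro tendsto_intros tendsto_ennrealI bounded_linear.tendsto[OF R])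
  qed simp
  finally show ?thesis .
qed

end


section \<open>The shell model operators\<close>

lemma suminf_shift_left_le:
  fixes s :: "nat \<Rightarrow> real"
  assumes "summable s" "\<And>n. 0 \<le> s n"
  shows "summable (\<lambda>n. s (n + k))" "(\<Sum>n. s (n + k)) \<le> suminf s"
  using suminf_split_initial_segment[OF assms(1), of k] assms
  by (auto simp: sum_nonneg summable_iff_shift)

lemma suminf_shift_right_eq:
  fixes s :: "nat \<Rightarrow> real"
  assumes "summable s" "s 0 = 0"
  shows "summable (\<lambda>n. s (n - k))" "(\<Sum>n. s (n - k)) = suminf s"
proof -
  show *: "summable (\<lambda>n. s (n - k))"
    using assms(1) summable_iff_shift[of "\<lambda>n. s (n - k)" k] by simp
  show "(\<Sum>n. s (n - k)) = suminf s"
    using suminf_split_initial_segment[OF *, of k] assms(2) by simp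
qed

text \<open>
  Each term of the bilinear map couples the coordinates \<open>n\<close> and \<open>n \<plusminus> 1\<close>, \<open>n \<plusminus> 2\<close>. Once the
  coefficients are bounded, such an operator is dominated by shifts, which do not increase the norm.
\<close>

lemma local_operator_bounded:
  fixes F :: "(nat \<Rightarrow> complex) \<Rightarrow> nat \<Rightarrow> complex"
  assumes F0: "\<And>u. F u 0 = 0"
    and add: "\<And>u v n. F (\<lambda>k. u k + v k) n = F u n + F v n"
    and scale: "\<And>r u n. F (\<lambda>k. r *\<^sub>R u k) n = r *\<^sub>R F u n"
    and bound: "\<And>x n. cmod (F (coord x) n) \<le> M * (cmod (coord x (n + 1)) + cmod (coord x (n + 2))
      + cmod (coord x (n - 1)) + cmod (coord x (n - 2)))"
    and M: "0 \<le> M"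
  shows "F (coord x) \<in> ell2_seq" and "bounded_linear (\<lambda>x. Abs_ell2 (F (coord x)))"
proof -
  have mem: "F (coord x) \<in> ell2_seq" "(norm (Abs_ell2 (F (coord x))))\<^sup>2 \<le> (4 * M * norm x)\<^sup>2" for x
  proof -
    define s where "s = (\<lambda>n. (cmod (coord x n))\<^sup>2)"
    have s: "summable s" "\<And>n. 0 \<le> s n" "s 0 = 0" "suminf s = (norm x)\<^sup>2"
      using summable_coord[of x] norm_ell2_sq[of x] by (auto simp: s_def)
    note l = suminf_shift_left_le[OF s(1,2)] and r = suminf_shift_right_eq[OF s(1,3)]
    define g where "g n = 4 * M\<^sup>2 * (s (n + 1) + s (n + 2) + s (n - 1) + s (n - 2))" for n
    have g: "summable g"
      unfolding g_def by (intro summable_mult summable_add l r)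
    have b: "(cmod (F (coord x) n))\<^sup>2 \<le> g n" for n
    proof -
      have sq: "(p + q + y + z)\<^sup>2 \<le> 4 * (p\<^sup>2 + q\<^sup>2 + y\<^sup>2 + z\<^sup>2)" for p q y z :: real
        using sum_squares_ge_zero[of "p - q" "y - z"] sum_squares_ge_zero[of "p - y" "q - z"]
          sum_squares_ge_zero[of "p - z" "q - y"]
        by (simp add: power2_eq_square algebra_simps)
      have "(cmod (F (coord x) n))\<^sup>2 \<le> (M * (cmod (coord x (n + 1)) + cmod (coord x (n + 2))
          + cmod (coord x (n - 1)) + cmod (coord x (n - 2))))\<^sup>2"
        by (intro power_mono bound) simp
      also have "\<dots> \<le> M\<^sup>2 * (4 * (s (n + 1) + s (n + 2) + s (n - 1) + s (n - 2)))"
        unfolding power_mult_distrib s_def by (intro mult_left_mono sq) simp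
      finally show ?thesis by (simp only: g_def mult.assoc mult.left_commute[of _ 4])
    qed
    show "F (coord x) \<in> ell2_seq" by (rule ell2_seq_comparison(1)[OF F0 g b])
    have "(norm (Abs_ell2 (F (coord x))))\<^sup>2 \<le> suminf g"
      by (rule ell2_seq_comparison(2)[OF F0 g b])
    also have "\<dots> = 4 * M\<^sup>2 * ((\<Sum>n. s (n + 1)) + (\<Sum>n. s (n + 2)) + (\<Sum>n. s (n - 1)) + (\<Sum>n. s (n - 2)))"
      unfolding g_def by (simp only: suminf_mult suminf_add[symmetric] summable_add l(1) r(1))
    also have "\<dots> \<le> 4 * M\<^sup>2 * (suminf s + suminf s + suminf s + suminf s)"
      by (intro mult_left_mono add_mono l(2) eq_refl[OF r(2)]) auto
    also have "\<dots> = (4 * M * norm x)\<^sup>2"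
      by (simp add: s(4) power_mult_distrib)
    finally show "(norm (Abs_ell2 (F (coord x))))\<^sup>2 \<le> (4 * M * norm x)\<^sup>2" .
  qed
  show "F (coord x) \<in> ell2_seq" by (rule mem)
  show "bounded_linear (\<lambda>x. Abs_ell2 (F (coord x)))"
  proof (rule bounded_linear_intro[where K = "4 * M"])
    fix x y :: ell2 and r :: real
    have "coord (x + y) = (\<lambda>n. coord x n + coord y n)" "coord (r *\<^sub>R x) = (\<lambda>n. r *\<^sub>R coord x n)"
      by (simp_all add: fun_eq_iff)
    then show "Abs_ell2 (F (coord (x + y))) = Abs_ell2 (F (coord x)) + Abs_ell2 (F (coord y))"
      "Abs_ell2 (F (coord (r *\<^sub>R x))) = r *\<^sub>R Abs_ell2 (F (coord x))"
      using mem(1)[of "x + y"] mem(1)[of "r *\<^sub>R x"]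
      by (auto intro!: ell2_eqI simp: coord_Abs mem(1) add scale)
    have "norm (Abs_ell2 (F (coord x))) \<le> 4 * M * norm x"
      by (rule power2_le_imp_le[OF mem(2)]) (use M in simp)
    then show "norm (Abs_ell2 (F (coord x))) \<le> norm x * (4 * M)" by (simp add: mult.commute)
  qed
qed

text \<open>
  Moving the index by two costs a factor \<open>\<lambda>\<^sup>2\<close>, and \<open>k\<^sub>j \<le> k\<^sub>j\<^sup>2 / k\<^sub>0\<close> compares the weight with that
  of \<open>A\<close>, whose image of \<open>u\<^sub>e\<close> has bounded coordinates.
\<close>

lemma A_dom_weighted_bound:
  assumes "1 < lam" "0 < k0" and ue: "ue \<in> A_dom k0 lam"
  obtains Q where "0 \<le> Q" "\<And>m j. m \<le> j + 2 \<Longrightarrow> \<bar>wavenumber k0 lam m\<bar> * cmod (coord ue j) \<le> Q"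
proof
  let ?k = "wavenumber k0 lam"
  let ?Q = "lam\<^sup>2 * (norm (A_op k0 lam ue) / k0)"
  show "0 \<le> ?Q" using assms by simp
  fix m j :: nat assume mj: "m \<le> j + 2"
  have pos: "0 < ?k i" for i using assms by (simp add: wavenumber_def)
  have "lam ^ m \<le> lam ^ (j + 2)" using assms mj by (intro power_increasing) auto
  then have k_le: "?k m \<le> lam\<^sup>2 * ?k j"
    using assms by (simp add: wavenumber_def power_add power2_eq_square mult.commute mult.left_commute)
  have le: "?k j * cmod (coord ue j) \<le> norm (A_op k0 lam ue) / k0"
  proof -
    have "k0 \<le> ?k j" using assms by (simp add: wavenumber_def one_le_power)
    then have "k0 * ?k j \<le> (?k j)\<^sup>2" using pos[of j] by (simp add: power2_eq_square)
    then have "k0 * ?k j * cmod (coord ue j) \<le> (?k j)\<^sup>2 * cmod (coord ue j)"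
      by (intro mult_right_mono) auto
    also have "\<dots> = cmod (coord (A_op k0 lam ue) j)"
      using ue by (simp add: A_op_def A_dom_def coord_Abs A_seq_def norm_mult norm_power)
    also have "\<dots> \<le> norm (A_op k0 lam ue)" by (rule cmod_coord_le)
    finally show ?thesis using assms by (simp add: field_simps)
  qed
  have "?k m * cmod (coord ue j) \<le> lam\<^sup>2 * ?k j * cmod (coord ue j)"
    by (intro mult_right_mono k_le) auto
  also have "\<dots> = lam\<^sup>2 * (?k j * cmod (coord ue j))" by (rule mult.assoc)
  also have "\<dots> \<le> ?Q" by (rule mult_left_mono[OF le]) simp
  finally have "?k m * cmod (coord ue j) \<le> ?Q" .
  then show "\<bar>?k m\<bar> * cmod (coord ue j) \<le> ?Q" using pos[of m] by simp
qed

lemma B_op_bounded: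
  assumes lam: "1 < lam" "0 < k0" and ue: "ue \<in> A_dom k0 lam"
  shows "B_seq k0 lam a b (coord x) (coord ue) \<in> ell2_seq"
    and "bounded_linear (\<lambda>x. B_op k0 lam a b x ue)"
    and "B_seq k0 lam a b (coord ue) (coord x) \<in> ell2_seq"
    and "bounded_linear (\<lambda>x. B_op k0 lam a b ue x)"
proof -
  obtain Q where Q: "0 \<le> Q" "\<And>m j. m \<le> j + 2 \<Longrightarrow> \<bar>wavenumber k0 lam m\<bar> * cmod (coord ue j) \<le> Q"
    by (rule A_dom_weighted_bound[OF lam ue]) blast
  let ?M = "(\<bar>a\<bar> + \<bar>b\<bar>) * Q"
  have M: "0 \<le> ?M" using Q by simp
  have term_le: "cmod p \<le> ?M * cmod z"
    if p: "cmod p = \<bar>c\<bar> * (\<bar>wavenumber k0 lam m\<bar> * cmod (coord ue j)) * cmod z"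
      and "m \<le> j + 2" "\<bar>c\<bar> \<le> \<bar>a\<bar> + \<bar>b\<bar>" for c m j p z
    unfolding p by (intro mult_right_mono mult_mono Q that) auto
  have four: "cmod (- \<i> * (p + q + y + z)) \<le> ?M * (cmod p' + cmod q' + cmod y' + cmod z')"
    if "cmod p \<le> ?M * cmod p'" "cmod q \<le> ?M * cmod q'" "cmod y \<le> ?M * cmod y'" "cmod z \<le> ?M * cmod z'"
    for p q y z p' q' y' z'
  proof -
    have "cmod (p + q + y + z) \<le> cmod p + cmod q + cmod y + cmod z"
      by (intro norm_triangle_mono order_refl)
    moreover have "cmod (- \<i> * (p + q + y + z)) = cmod (p + q + y + z)"
      by (simp only: norm_mult norm_minus_cancel norm_ii mult_1)
    ultimately show ?thesis using that unfolding distrib_left by linarith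
  qed
  let ?F1 = "\<lambda>u. B_seq k0 lam a b u (coord ue)" and ?F2 = "B_seq k0 lam a b (coord ue)"
  let ?S = "\<lambda>x n. cmod (coord x (n + 1)) + cmod (coord x (n + 2)) + cmod (coord x (n - 1)) + cmod (coord x (n - 2))"
  have b1: "cmod (?F1 (coord x) n) \<le> 2 * ?M * ?S x n" for x n
  proof (cases "n = 0")
    case False
    have "cmod (?F1 (coord x) n) \<le> ?M * (cmod (coord x (n + 1)) + cmod (coord x (n - 1))
        + cmod (coord x (n - 1)) + cmod (coord x (n - 2)))"
      unfolding B_seq_def Let_def if_not_P[OF False]
      by (rule four[OF term_le[where c = a and m = "n + 1" and j = "n + 2"]
          term_le[where c = b and m = "n" and j = "n + 1"]
          term_le[where c = a and m = "n - 1" and j = "n - 2"]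
          term_le[where c = b and m = "n - 1" and j = "n - 1"]])
        (simp_all add: norm_mult abs_mult mult.assoc)
    also have "\<dots> \<le> ?M * (2 * ?S x n)" by (intro mult_left_mono M) auto
    finally show ?thesis by (simp only: mult_ac)
  qed (use Q in \<open>simp add: B_seq_def\<close>)
  have b2: "cmod (?F2 (coord x) n) \<le> 2 * ?M * ?S x n" for x n
  proof (cases "n = 0")
    case False
    have "cmod (?F2 (coord x) n) \<le> ?M * (cmod (coord x (n + 2)) + cmod (coord x (n + 1))
        + cmod (coord x (n - 2)) + cmod (coord x (n - 1)))"
      unfolding B_seq_def Let_def if_not_P[OF False]
      by (rule four[OF term_le[where c = a and m = "n + 1" and j = "n + 1"]
          term_le[where c = b and m = "n" and j = "n - 1"]
          term_le[where c = a and m = "n - 1" and j = "n - 1"]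
          term_le[where c = b and m = "n - 1" and j = "n - 2"]])
        (simp_all add: norm_mult abs_mult mult.assoc)
    also have "\<dots> \<le> ?M * (2 * ?S x n)" by (intro mult_left_mono M) auto
    finally show ?thesis by (simp only: mult_ac)
  qed (use Q in \<open>simp add: B_seq_def\<close>)
  have M2: "0 \<le> 2 * ?M" using M by simp
  have 1: "?F1 (\<lambda>k. u k + v k) n = ?F1 u n + ?F1 v n" "?F1 (\<lambda>k. r *\<^sub>R u k) n = r *\<^sub>R ?F1 u n" "?F1 u 0 = 0"
    for u v n r
    by (simp_all add: B_seq_def Let_def algebra_simps)
  have 2: "?F2 (\<lambda>k. u k + v k) n = ?F2 u n + ?F2 v n" "?F2 (\<lambda>k. r *\<^sub>R u k) n = r *\<^sub>R ?F2 u n" "?F2 u 0 = 0"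
    for u v n r
    by (simp_all add: B_seq_def Let_def algebra_simps)
  show "?F1 (coord x) \<in> ell2_seq" "bounded_linear (\<lambda>x. B_op k0 lam a b x ue)"
    unfolding B_op_def by (rule local_operator_bounded[OF 1(3,1,2) b1 M2])+
  show "?F2 (coord x) \<in> ell2_seq" "bounded_linear (\<lambda>x. B_op k0 lam a b ue x)"
    unfolding B_op_def by (rule local_operator_bounded[OF 2(3,1,2) b2 M2])+
qed

lemma A_dom_eq_diag_dom:
  assumes "0 < nu"
  shows "A_dom k0 lam = diag_dom (\<lambda>n. nu * (wavenumber k0 lam n)\<^sup>2)"
proof -
  have "A_seq k0 lam (coord u) \<in> ell2_seq \<longleftrightarrow> (\<lambda>n. of_real nu * A_seq k0 lam (coord u) n) \<in> ell2_seq" for u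
  proof
    assume "(\<lambda>n. of_real nu * A_seq k0 lam (coord u) n) \<in> ell2_seq"
    from ell2_seq_mult[OF this, of "of_real (1 / nu)"] show "A_seq k0 lam (coord u) \<in> ell2_seq"
      using assms by simp
  qed (rule ell2_seq_mult)
  then show ?thesis
    by (simp add: A_dom_def diag_dom_def A_seq_def[abs_def] mult.assoc)
qed

lemma nu_A_op_eq_diag:
  assumes "0 < nu" "u \<in> A_dom k0 lam"
  shows "nu *\<^sub>R A_op k0 lam u = diag (\<lambda>n. nu * (wavenumber k0 lam n)\<^sup>2) u"
proof (rule ell2_eqI)
  fix n
  have "u \<in> diag_dom (\<lambda>n. nu * (wavenumber k0 lam n)\<^sup>2)"
    using assms A_dom_eq_diag_dom by blast
  then show "coord (nu *\<^sub>R A_op k0 lam u) n = coord (diag (\<lambda>n. nu * (wavenumber k0 lam n)\<^sup>2) u) n"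
    using assms(2) by (simp add: coord_diag_dom A_op_def A_dom_def coord_Abs A_seq_def scaleR_conv_of_real mult.assoc)
qed

lemma basis_in_A_dom: "basis n z \<in> A_dom k0 lam"
proof -
  have "summable (\<lambda>m. (cmod (A_seq k0 lam (coord (basis n z)) m))\<^sup>2)"
    by (rule summable_finite[of "{n}"]) (auto simp: A_seq_def coord_basis)
  then show ?thesis by (simp add: A_dom_def ell2_seq_def A_seq_def)
qed


section \<open>The closed loop\<close>

lemma solves_cong:
  assumes "D = D'" "\<And>x. x \<in> D' \<Longrightarrow> L x = L' x"
  shows "solves D L g u0 u \<longleftrightarrow> solves D' L' g u0 u"
  unfolding solves_def using assms by auto

text \<open>
  The domain of the closed loop operator only asks for the formal sum to be square-summable. As all terms
  except the diagonal one are square-summable for every \<open>x\<close>, this happens exactly on \<open>D(A)\<close>.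
\<close>

lemma closed_loop_eq_perturbed_diagonal:
  fixes a b :: real
  assumes "1 < lam" "0 < k0" "0 < nu" "ue \<in> A_dom k0 lam" "bounded_linear B1" "bounded_linear R"
  defines "\<mu> \<equiv> \<lambda>n. nu * (wavenumber k0 lam n)\<^sup>2"
    and "K \<equiv> \<lambda>x. B_op k0 lam a b x ue + B_op k0 lam a b ue x + B1 (adjoint B1 (R x))"
  shows "bounded_linear K"
    and "closed_dom k0 lam nu a b ue B1 R = diag_dom \<mu>"
    and "\<And>x. x \<in> diag_dom \<mu> \<Longrightarrow> closed_op k0 lam nu a b ue B1 R x = diag \<mu> x + K x"
proof -
  note B = B_op_bounded[OF assms(1,2,4), where a = a and b = b]
  have FB: "bounded_linear (\<lambda>x. B1 (adjoint B1 (R x)))"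
    by (intro bounded_linear_compose[OF assms(5)] bounded_linear_compose[OF bounded_linear_adjoint[OF assms(5)]] assms(6))
  show "bounded_linear K"
    unfolding K_def by (intro bounded_linear_add B FB)
  have coord_K: "coord (K x) n = B_seq k0 lam a b (coord x) (coord ue) n + B_seq k0 lam a b (coord ue) (coord x) n
      + coord (B1 (adjoint B1 (R x))) n" for x n
    by (simp add: K_def B_op_def coord_Abs B)
  have split: "(\<lambda>n. lin_seq k0 lam nu a b ue (coord x) n + coord (B1 (adjoint B1 (R x))) n)
      = (\<lambda>n. of_real (\<mu> n) * coord x n + coord (K x) n)" for x
    by (simp add: fun_eq_iff coord_K lin_seq_def A_seq_def \<mu>_def)
  have "(\<lambda>n. of_real (\<mu> n) * coord x n + coord (K x) n) \<in> ell2_seq \<longleftrightarrow> x \<in> diag_dom \<mu>" for x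
  proof
    assume "(\<lambda>n. of_real (\<mu> n) * coord x n + coord (K x) n) \<in> ell2_seq"
    from ell2_seq_add[OF this coord[of "- K x"]] show "x \<in> diag_dom \<mu>" by (simp add: diag_dom_def)
  qed (auto simp: diag_dom_def intro: ell2_seq_add coord)
  then show "closed_dom k0 lam nu a b ue B1 R = diag_dom \<mu>"
    by (auto simp: closed_dom_def split)
  show "closed_op k0 lam nu a b ue B1 R x = diag \<mu> x + K x" if "x \<in> diag_dom \<mu>" for x
    using nu_A_op_eq_diag[OF assms(3), of x k0 lam] that A_dom_eq_diag_dom[OF assms(3), of k0 lam]
    by (simp add: closed_op_def lin_op_def K_def \<mu>_def add.assoc)
qed

text \<open>
  Pairing the Riccati equation with \<open>u\<close> shows that \<open>(u, Ru)\<close> is a storage function of the closed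
  loop: the feedback contributes \<open>2|B\<^sub>1\<^sup>*Ru|\<^sup>2\<close>, which turns the sign of the term coming from the
  equation.
\<close>

lemma closed_loop_dissipation:
  assumes B1: "bounded_linear B1" and B2: "bounded_linear B2"
    and R_sym: "\<And>x y. inner (R x) y = inner x (R y)"
    and ric: "riccati (A_dom k0 lam) (lin_op k0 lam nu a b ue) B1 B2 \<gamma> R"
    and u: "u \<in> A_dom k0 lam"
  shows "2 * inner (closed_op k0 lam nu a b ue B1 R u) (R u)
    = (norm u)\<^sup>2 + (norm (adjoint B1 (R u)))\<^sup>2 + (1 / \<gamma>) * (norm (adjoint B2 (R u)))\<^sup>2"
proof -
  let ?L = "lin_op k0 lam nu a b ue" and ?D = "A_dom k0 lam"
  have dom: "R u \<in> adj_dom ?D ?L"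
    and eq: "adj_op ?D ?L (R u) + R (?L u) + R (B1 (adjoint B1 (R u)))
          - (1 / \<gamma>) *\<^sub>R R (B2 (adjoint B2 (R u))) - u = 0"
    using ric u by (auto simp: riccati_def)
  have quad: "inner u (R (B (adjoint B (R u)))) = (norm (adjoint B (R u)))\<^sup>2" if "bounded_linear B" for B :: "ell2 \<Rightarrow> ell2"
    by (metis R_sym inner_adjoint[OF that] inner_commute power2_norm_eq_inner)
  have "inner u (adj_op ?D ?L (R u)) = inner (?L u) (R u)"
    by (rule inner_adj_op[OF basis_in_A_dom dom u, symmetric])
  moreover have "inner u (R (?L u)) = inner (?L u) (R u)"
    by (metis R_sym inner_commute)
  moreover have "inner u (adj_op ?D ?L (R u) + R (?L u) + R (B1 (adjoint B1 (R u)))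
          - (1 / \<gamma>) *\<^sub>R R (B2 (adjoint B2 (R u))) - u) = 0"
    unfolding eq by simp
  ultimately have "2 * inner (?L u) (R u) + (norm (adjoint B1 (R u)))\<^sup>2
      - (1 / \<gamma>) * (norm (adjoint B2 (R u)))\<^sup>2 - (norm u)\<^sup>2 = 0"
    by (simp add: inner_add_right inner_diff_right quad[OF B1] quad[OF B2] power2_norm_eq_inner[of u])
  moreover have "inner (closed_op k0 lam nu a b ue B1 R u) (R u) = inner (?L u) (R u) + (norm (adjoint B1 (R u)))\<^sup>2"
    by (simp add: closed_op_def inner_add_left inner_adjoint[OF B1] power2_norm_eq_inner)
  ultimately show ?thesis by (simp add: algebra_simps)
qed

theorem theorem4p19:
  fixes lam k0 nu a b c \<gamma> \<gamma>0 :: real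
    and ue f :: ell2
    and B1 B2 R :: "ell2 \<Rightarrow> ell2"
  assumes "1 < lam" and "0 < k0" and "0 < nu" and "a + b + c = 0"
    and "ue \<in> A_dom k0 lam"
    and "nu *\<^sub>R A_op k0 lam ue + B_op k0 lam a b ue ue = f"
    and "bounded_linear B1" and "bounded_linear B2"
    and "gamma_threshold (A_dom k0 lam) (lin_op k0 lam nu a b ue) B1 B2 \<gamma>0"
    and "\<gamma> > \<gamma>0"
    and "costate_operator (A_dom k0 lam) (lin_op k0 lam nu a b ue) B1 B2 \<gamma> R"
    and "\<And>x y. inner (R x) y = inner x (R y)"
    and "\<And>x. 0 \<le> inner (R x) x"
    and "riccati (A_dom k0 lam) (lin_op k0 lam nu a b ue) B1 B2 \<gamma> R"
  shows "\<exists>C>0. \<forall>w\<in>L2H. \<forall>u0. \<exists>u.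
      solves (closed_dom k0 lam nu a b ue B1 R) (closed_op k0 lam nu a b ue B1 R)
        (\<lambda>t. B2 (w t)) u0 u \<and>
      (\<forall>v. solves (closed_dom k0 lam nu a b ue B1 R) (closed_op k0 lam nu a b ue B1 R)
             (\<lambda>t. B2 (w t)) u0 v \<longrightarrow> (\<forall>t\<ge>0. v t = u t)) \<and>
      sq_int u + sq_int (\<lambda>t. adjoint B1 (R (u t)))
        \<le> ennreal (C * (norm u0)\<^sup>2) + ennreal \<gamma> * sq_int w"
proof -
  have \<gamma>: "0 < \<gamma>" using assms(9,10) by (simp add: gamma_threshold_def)
  have R: "bounded_linear R" using assms(11) by (simp add: costate_operator_def)
  define \<mu> where "\<mu> n = nu * (wavenumber k0 lam n)\<^sup>2" for n
  have \<mu>: "0 \<le> \<mu> n" for n using assms(3) by (simp add: \<mu>_def)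
  define K where "K x = B_op k0 lam a b x ue + B_op k0 lam a b ue x + B1 (adjoint B1 (R x))" for x
  define L where "L x = diag \<mu> x + K x" for x
  note cl = closed_loop_eq_perturbed_diagonal[OF assms(1-3,5,7) R, where a = a and b = b,
      folded \<mu>_def K_def, folded L_def]
  have K: "bounded_linear K" by (rule cl(1))
  have solves_iff: "solves (closed_dom k0 lam nu a b ue B1 R) (closed_op k0 lam nu a b ue B1 R) g u0 u
      \<longleftrightarrow> solves (diag_dom \<mu>) L g u0 u" for g u0 u
    by (rule solves_cong[OF cl(2,3)])
  have L_diff: "x - y \<in> diag_dom \<mu> \<and> L (x - y) = L x - L y" if "x \<in> diag_dom \<mu>" "y \<in> diag_dom \<mu>" for x y
    using that by (simp add: L_def diag_dom_diff linear_diff[OF bounded_linear.linear[OF K]])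
  have L_scaleR: "r *\<^sub>R x \<in> diag_dom \<mu> \<and> L (r *\<^sub>R x) = r *\<^sub>R L x" if "x \<in> diag_dom \<mu>" for r x
    using that by (simp add: L_def diag_dom_scaleR linear_scale[OF bounded_linear.linear[OF K]] scaleR_add_right)
  have BR: "bounded_linear (\<lambda>x. adjoint B1 (R x))"
    by (intro bounded_linear_compose[OF bounded_linear_adjoint[OF assms(7)]] R)
  have diss: "2 * inner (L x) (R x) = (norm x)\<^sup>2 + (norm (adjoint B1 (R x)))\<^sup>2 + (1 / \<gamma>) * (norm (adjoint B2 (R x)))\<^sup>2"
    if "x \<in> diag_dom \<mu>" for x
    using closed_loop_dissipation[OF assms(7,8,12,14), of x] that cl(3)[OF that]
      A_dom_eq_diag_dom[OF assms(3), of k0 lam, folded \<mu>_def] by simp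
  obtain C where C: "\<And>x. norm (R x) \<le> norm x * C" "0 < C" using bounded_linear.pos_bounded[OF R] by auto
  have value_le: "inner x (R x) \<le> C * (norm x)\<^sup>2" for x
  proof -
    have "inner x (R x) \<le> norm x * norm (R x)" by (rule norm_cauchy_schwarz)
    also have "\<dots> \<le> norm x * (norm x * C)" by (intro mult_left_mono C) simp
    finally show ?thesis by (simp add: power2_eq_square mult.commute mult.left_commute)
  qed
  show ?thesis
  proof (intro exI[of _ C] conjI ballI allI C(2))
    fix w u0 assume w: "w \<in> L2H"
    obtain N where N: "0 \<le> N" "\<And>t. 0 \<le> t \<Longrightarrow> (LINT s:{0..t}|lborel. norm (B2 (w s))) \<le> N + t"
      by (rule L2H_growth[OF w assms(8)]) blast
    obtain u where u: "solves (diag_dom \<mu>) L (\<lambda>t. B2 (w t)) u0 u"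
      using exists_perturbed_solution[where \<mu> = \<mu>, OF \<mu> K
          locally_integrable_bounded_linear[OF assms(8) L2H_locally_integrable[OF w]] N]
      unfolding L_def by blast
    have unique: "v t = u t" if "solves (diag_dom \<mu>) L (\<lambda>t. B2 (w t)) u0 v" "0 \<le> t" for v t
      using perturbed_solution_unique[where \<mu> = \<mu>, OF \<mu> K _ _ that(2)] that(1) u unfolding L_def by blast
    have "sq_int u + sq_int (\<lambda>t. adjoint B1 (R (u t))) \<le> ennreal (inner u0 (R u0)) + ennreal \<gamma> * sq_int w"
      by (rule energy_estimate[OF L_diff L_scaleR R assms(12,13) BR assms(8) \<gamma> diss u w])
    also have "\<dots> \<le> ennreal (C * (norm u0)\<^sup>2) + ennreal \<gamma> * sq_int w"
      by (intro add_right_mono ennreal_leI value_le)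
    finally show "\<exists>u. solves (closed_dom k0 lam nu a b ue B1 R) (closed_op k0 lam nu a b ue B1 R)
        (\<lambda>t. B2 (w t)) u0 u \<and>
      (\<forall>v. solves (closed_dom k0 lam nu a b ue B1 R) (closed_op k0 lam nu a b ue B1 R)
             (\<lambda>t. B2 (w t)) u0 v \<longrightarrow> (\<forall>t\<ge>0. v t = u t)) \<and>
      sq_int u + sq_int (\<lambda>t. adjoint B1 (R (u t)))
        \<le> ennreal (C * (norm u0)\<^sup>2) + ennreal \<gamma> * sq_int w"
      unfolding solves_iff using u unique by blast
  qed
qed

end
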